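(* Let $R$ be a commutative ring and let $n \geq 0$. There exist ordered bases of $\Lambda_1(R^{n+1})$ and of $\Lambda_0(R^{n+1})$ such that for all $(b,f)\in (R^{n+1})^\vee=R^{n+1}$ and $(a,p)\in R^{n+1}$ (with $a,b\in R$ and $p,f\in R^n$) and all $\varphi\in SL_{n+1}(R)$, one has $$S_{n+1}\bigl((b,f)\circ\varphi,\ \varphi^{-1}(a,p)\bigr)=B_\varphi^{-1}\,S_{n+1}(b,f,a,p)\,A_\varphi,$$ where $A_\varphi$ and $B_\varphi$ are the matrices representing $\Lambda_1(\varphi)$ and $\Lambda_0(\varphi)$, respectively, with respect to these bases.
   Context: $R$ is a commutative ring; $R^m$ is identified with $(R^m)^\vee$ via the standard basis and its dual basis. Suslin matrices: for $m\ge 1$ and $u=(u_1,\dots,u_m), v=(v_1,\dots,v_m)\in R^m$, the $2^{m-1}\times 2^{m-1}$ matrix $S_m(u,v)$ is defined by $S_1(u,v)=(u_1)$ and, for $m\geq 2$, with $u'=(u_2,\dots,u_m)$, $v'=(v_2,\dots,v_m)$ and $I$ the identity matrix of size $2^{m-2}$, $$S_m(u,v)=\begin{pmatrix} u_1 I & S_{m-1}(u',v')\\ -S_{m-1}(v',u')^t & v_1 I\end{pmatrix}.$$ For $p,f\in R^n$ and $a,b\in R$, $S_{n+1}(b,f,a,p)$ means $S_{n+1}(u,v)$ with $u=(b,f)=(b,f_1,\dots,f_n)$ and $v=(a,p)=(a,p_1,\dots,p_n)$. Exterior algebra: $\Lambda_0(R^{n+1})=\bigoplus_{i\ge0}\Lambda^{2i}(R^{n+1})$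 and $\Lambda_1(R^{n+1})=\bigoplus_{i\ge0}\Lambda^{2i+1}(R^{n+1})$, both free of rank $2^n$. A matrix $\varphi\in SL_{n+1}(R)$, viewed as an automorphism of $R^{n+1}$ (column vectors), induces an automorphism of $\Lambda(R^{n+1})$ preserving these two summands; $\Lambda_0(\varphi)$ and $\Lambda_1(\varphi)$ denote the restrictions. The linear form $(b,f):R^{n+1}\to R$ is the row vector $(b,f_1,\dots,f_n)$, and $(b,f)\circ\varphi$ is its composition with $\varphi$ (row vector times matrix), again regarded as an element of $R^{n+1}$; $\varphi^{-1}(a,p)$ is $\varphi^{-1}$ applied to the column vector $(a,p_1,\dots,p_n)^t$. *)

theory Defs
  imports "Jordan_Normal_Form.Determinant" "HOL-Algebra.QuotRing" "HOL-Algebra.Module"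
begin

hide_const (open) Polynomial.smult

section \<open>Suslin matrices\<close>

text \<open>
  Vectors and matrices are indexed from 0, so \<^term>\<open>u $ 0\<close> is the entry written $u_1$ on paper
  and \<^term>\<open>vec_tail u\<close> is $u'$.  Suslin matrices are only meaningful for \<open>m \<ge> 1\<close>; the value
  at \<open>m = 0\<close> is left unspecified.
\<close>

definition vec_tail :: "'a vec \<Rightarrow> 'a vec" where
  "vec_tail u = vec (dim_vec u - 1) (\<lambda>i. u $ Suc i)"

fun suslin :: "nat \<Rightarrow> 'a::comm_ring_1 vec \<Rightarrow> 'a vec \<Rightarrow> 'a mat" where
  "suslin (Suc 0) u v = mat 1 1 (\<lambda>_. u $ 0)"
| "suslin (Suc (Suc k)) u v =
     four_block_mat
       (u $ 0 \<cdot>\<^sub>m 1\<^sub>m (2 ^ k))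
       (suslin (Suc k) (vec_tail u) (vec_tail v))
       (- transpose_mat (suslin (Suc k) (vec_tail v) (vec_tail u)))
       (v $ 0 \<cdot>\<^sub>m 1\<^sub>m (2 ^ k))"


section \<open>Matrix inverse and row vector times matrix\<close>

abbreviation mat_inv :: "'a::comm_ring_1 mat \<Rightarrow> 'a mat" where
  "mat_inv A \<equiv> inv\<^bsub>ring_mat TYPE('a) (dim_row A) ()\<^esub> A"

definition form_comp :: "'a::comm_ring_1 vec \<Rightarrow> 'a mat \<Rightarrow> 'a vec" where
  "form_comp u A = row (mat_of_row u * A) 0"


section \<open>The tensor algebra of a free module with standard basis\<close>

text \<open>
  \<open>R\<^sup>m\<close> is free on $e_0,\dots,e_{m-1}$, so its $k$-th tensor power is free on the tensors
  $e_{w_1} \otimes \dots \otimes e_{w_k}$.  A tensor is therefore represented by its coefficient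
  function on words \<open>w\<close> in the letters \<open>{..<m}\<close>; the product of the tensor algebra is the bilinear
  extension of concatenation of words.
\<close>

definition tensor_mult :: "(nat list \<Rightarrow> 'a::comm_ring_1) \<Rightarrow> (nat list \<Rightarrow> 'a) \<Rightarrow> nat list \<Rightarrow> 'a" where
  "tensor_mult x y = (\<lambda>w. \<Sum>k\<le>length w. x (take k w) * y (drop k w))"

definition tensor_one :: "nat list \<Rightarrow> 'a::comm_ring_1" where
  "tensor_one = (\<lambda>w. if w = [] then 1 else 0)"

definition tensor_algebra :: "nat \<Rightarrow> ('a::comm_ring_1, nat list \<Rightarrow> 'a) module" where
  "tensor_algebra m =
     \<lparr>carrier = {x. finite {w. x w \<noteq> 0} \<and> (\<forall>w. x w \<noteq> 0 \<longrightarrow> set w \<subseteq> {..<m})},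
      mult = tensor_mult,
      one = tensor_one,
      zero = (\<lambda>w. 0),
      add = (\<lambda>x y w. x w + y w),
      smult = (\<lambda>c x w. c * x w)\<rparr>"

definition tensor_of_vec :: "'a::comm_ring_1 vec \<Rightarrow> nat list \<Rightarrow> 'a" where
  "tensor_of_vec v = (\<lambda>w. case w of [i] \<Rightarrow> (if i < dim_vec v then v $ i else 0) | _ \<Rightarrow> 0)"

text \<open>The action of a matrix on tensors:
  $e_{w_1} \otimes \dots \otimes e_{w_k} \mapsto \varphi e_{w_1} \otimes \dots \otimes \varphi e_{w_k}$,
  extended linearly.\<close>

definition tensor_map :: "'a::comm_ring_1 mat \<Rightarrow> (nat list \<Rightarrow> 'a) \<Rightarrow> nat list \<Rightarrow> 'a" where
  "tensor_map \<phi> x =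
     (\<lambda>u. \<Sum>w | x w \<noteq> 0.
        x w * foldr tensor_mult (map (\<lambda>j. tensor_of_vec (col \<phi> j)) w) tensor_one u)"


section \<open>The exterior algebra\<close>

text \<open>The quotient of the tensor algebra by the two-sided ideal generated by all $v \otimes v$.\<close>

definition ext_ideal :: "nat \<Rightarrow> (nat list \<Rightarrow> 'a::comm_ring_1) set" where
  "ext_ideal m =
     Idl\<^bsub>tensor_algebra m\<^esub>
       {tensor_mult (tensor_of_vec v) (tensor_of_vec v) | v. v \<in> carrier_vec m}"

definition ext_class :: "nat \<Rightarrow> (nat list \<Rightarrow> 'a::comm_ring_1) \<Rightarrow> (nat list \<Rightarrow> 'a) set" where
  "ext_class m x = ext_ideal m +>\<^bsub>tensor_algebra m\<^esub> x"

text \<open>The operation \<open>Quot\<close> only yields a ring, so the induced scalar multiplication is added.\<close>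

definition ext_algebra :: "nat \<Rightarrow> ('a::comm_ring_1, (nat list \<Rightarrow> 'a) set) module" where
  "ext_algebra m =
     ring.extend (tensor_algebra m Quot ext_ideal m)
       (module.fields (\<lambda>c X. \<Union>x\<in>X. ext_class m (c \<odot>\<^bsub>tensor_algebra m\<^esub> x)))"

text \<open>For a set \<open>K\<close> of degrees, \<open>ext_part K m\<close> is the sum of the $\Lambda^k(R^m)$ with \<open>k \<in> K\<close>.\<close>

definition ext_part :: "nat set \<Rightarrow> nat \<Rightarrow> (nat list \<Rightarrow> 'a::comm_ring_1) set set" where
  "ext_part K m =
     {ext_class m x | x. x \<in> carrier (tensor_algebra m) \<and> (\<forall>w. x w \<noteq> 0 \<longrightarrow> length w \<in> K)}"

definition ext_even :: "nat \<Rightarrow> (nat list \<Rightarrow> 'a::comm_ring_1) set set" where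
  "ext_even m = ext_part {k. even k} m"

definition ext_odd :: "nat \<Rightarrow> (nat list \<Rightarrow> 'a::comm_ring_1) set set" where
  "ext_odd m = ext_part {k. odd k} m"

text \<open>The endomorphism of the exterior algebra induced by a square matrix of size \<open>m\<close>.  The
  union is over all representatives of the class \<open>X\<close>; they all have the same image.\<close>

definition ext_map ::
    "nat \<Rightarrow> 'a::comm_ring_1 mat \<Rightarrow> (nat list \<Rightarrow> 'a) set \<Rightarrow> (nat list \<Rightarrow> 'a) set" where
  "ext_map m \<phi> X = (\<Union>x\<in>X. ext_class m (tensor_map \<phi> x))"


section \<open>Ordered bases and representing matrices\<close>

definition list_lincomb :: "('a, 'b) module \<Rightarrow> 'b list \<Rightarrow> 'a vec \<Rightarrow> 'b" where
  "list_lincomb M bs c = (\<Oplus>\<^bsub>M\<^esub>i\<in>{..<length bs}. c $ i \<odot>\<^bsub>M\<^esub> bs ! i)"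

definition ordered_basis :: "('a, 'b) module \<Rightarrow> 'b set \<Rightarrow> 'b list \<Rightarrow> bool" where
  "ordered_basis M N bs \<longleftrightarrow>
     set bs \<subseteq> N \<and> (\<forall>x\<in>N. \<exists>!c. c \<in> carrier_vec (length bs) \<and> list_lincomb M bs c = x)"

definition coords :: "('a, 'b) module \<Rightarrow> 'b list \<Rightarrow> 'b \<Rightarrow> 'a vec" where
  "coords M bs x = (THE c. c \<in> carrier_vec (length bs) \<and> list_lincomb M bs c = x)"

text \<open>Coordinates of the images of the basis vectors are the columns of the matrix.\<close>

definition repr_mat :: "('a, 'b) module \<Rightarrow> 'b list \<Rightarrow> ('b \<Rightarrow> 'b) \<Rightarrow> 'a mat" where
  "repr_mat M bs L = mat (length bs) (length bs) (\<lambda>(i, j). coords M bs (L (bs ! j)) $ i)"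

end

(*
  Coordinates on the exterior algebra of R^m are functions on bit strings of length m, where a
  string stands for the set of indices of its True entries.  The operator "contraction
  with u plus wedge product with v" splits along the first bit exactly as S_m(u, v) splits into four
  blocks, so S_m(u, v) is its matrix from odd to even degree, in suitably ordered monomial bases,
  and S_m(v, u)^t is its matrix from even to odd degree; this pair of facts is proved together by
  induction.  The equivariance then says that Lambda(phi) intertwines this operator for
  ((b,f) phi, phi^-1 (a,p)) with the one for ((b,f), (a,p)), which follows by induction on words
  from the Clifford relation between contraction and wedge.

  The monomials are independent in the quotient of the tensor algebra because letting words act by
  wedge operators, whose squares vanish, gives a representation that kills the ideal.  The same
  representation with the columns of phi in place of the unit vectors computes Lambda(phi).
*)

theory Submission
  imports Defs
begin

section \<open>The Clifford operator\<close>

text \<open>The pair (u, v) is treated as one operator because its square is the scalar sum of the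
  u_i v_i. Polarising this identity in v gives the relation between contraction and wedge over every
  commutative ring, without halving. The conjugation formula is reached through the inverse-free
  identity B S(u', v') = S(u, v) A, where u' = u \<phi> and v = \<phi> v': forms pull back, vectors
  push forward. The inverse of B then comes from functoriality applied to the adjugate of \<phi>.
  Since the exterior algebra is a quotient by a generated ideal, its elements must first be brought
  to normal form: words are sorted modulo the ideal, which gives spanning, and the representation
  then identifies the coefficients. Vectors are functions on all naturals and bit strings carry
  their own length. The operators therefore have no dimension parameter and pass to tails without
  index bookkeeping; in exchange, congruence lemmas must say that only entries below the length
  matter.\<close>

text \<open>
  A function on bit strings of length \<open>m\<close> is an element of $\Lambda(R^m)$: its value at \<open>s\<close> is the
  coefficient of the product of the $e_i$ with \<open>s ! i = True\<close>, in increasing order of \<open>i\<close>. On it,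
  \<open>clifford u v\<close> is contraction with the form \<open>u\<close> plus left multiplication by the vector \<open>v\<close>;
  the sign in the last equation comes from moving past the leading $e_0$.
\<close>

fun clifford ::
    "(nat \<Rightarrow> 'a::comm_ring_1) \<Rightarrow> (nat \<Rightarrow> 'a) \<Rightarrow> (bool list \<Rightarrow> 'a) \<Rightarrow> bool list \<Rightarrow> 'a" where
  "clifford u v g [] = 0"
| "clifford u v g (False # s) =
     u 0 * g (True # s) + clifford (\<lambda>i. u (Suc i)) (\<lambda>i. v (Suc i)) (\<lambda>t. g (False # t)) s"
| "clifford u v g (True # s) =
     v 0 * g (False # s) - clifford (\<lambda>i. u (Suc i)) (\<lambda>i. v (Suc i)) (\<lambda>t. g (True # t)) s"

abbreviation wedge :: "(nat \<Rightarrow> 'a::comm_ring_1) \<Rightarrow> (bool list \<Rightarrow> 'a) \<Rightarrow> bool list \<Rightarrow> 'a" where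
  "wedge \<equiv> clifford (\<lambda>_. 0)"

text \<open>Entries such as \<open>u $ i\<close> beyond the dimension are unspecified; this confines
  every evaluation to entries below the length of the string.\<close>

lemma clifford_cong:
  assumes "\<And>i. i < length s \<Longrightarrow> u i = u' i" "\<And>i. i < length s \<Longrightarrow> v i = v' i"
    and "\<And>t. length t = length s \<Longrightarrow> g t = h t"
  shows "clifford u v g s = clifford u' v' h s"
  using assms
proof (induction u v g s arbitrary: u' v' h rule: clifford.induct)
  case (2 u v g s)
  have "clifford (\<lambda>i. u (Suc i)) (\<lambda>i. v (Suc i)) (\<lambda>t. g (False # t)) s
      = clifford (\<lambda>i. u' (Suc i)) (\<lambda>i. v' (Suc i)) (\<lambda>t. h (False # t)) s"
    by (rule "2.IH") (simp_all add: "2.prems")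
  then show ?case by (simp add: "2.prems")
next
  case (3 u v g s)
  have "clifford (\<lambda>i. u (Suc i)) (\<lambda>i. v (Suc i)) (\<lambda>t. g (True # t)) s
      = clifford (\<lambda>i. u' (Suc i)) (\<lambda>i. v' (Suc i)) (\<lambda>t. h (True # t)) s"
    by (rule "3.IH") (simp_all add: "3.prems")
  then show ?case by (simp add: "3.prems")
qed simp

lemma clifford_add: "clifford u v (\<lambda>t. g t + h t) s = clifford u v g s + clifford u v h s"
  by (induction u v g s arbitrary: h rule: clifford.induct)
    (simp_all only: clifford.simps, simp_all add: algebra_simps)

lemma clifford_scale: "clifford u v (\<lambda>t. c * g t) s = c * clifford u v g s"
  by (induction u v g s rule: clifford.induct) (simp_all add: algebra_simps)

lemma clifford_zero [simp]: "clifford u v (\<lambda>_. 0) s = 0"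
  using clifford_scale[of u v 0 "\<lambda>_. 0" s] by simp

lemma clifford_minus: "clifford u v (\<lambda>t. - g t) s = - clifford u v g s"
  using clifford_scale[of u v "-1" g s] by simp

lemma clifford_diff: "clifford u v (\<lambda>t. g t - h t) s = clifford u v g s - clifford u v h s"
  using clifford_add[of u v g "\<lambda>t. - h t" s] by (simp add: clifford_minus)

lemma clifford_sum: "clifford u v (\<lambda>t. \<Sum>x\<in>A. f x t) s = (\<Sum>x\<in>A. clifford u v (f x) s)"
  by (induction A rule: infinite_finite_induct) (simp_all add: clifford_add)

lemma clifford_add_vec:
  "clifford (\<lambda>i. u i + u' i) (\<lambda>i. v i + v' i) g s = clifford u v g s + clifford u' v' g s"
  by (induction u v g s arbitrary: u' v' rule: clifford.induct)
    (simp_all only: clifford.simps, simp_all add: algebra_simps)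

lemma clifford_scale_vec: "clifford (\<lambda>i. c * u i) (\<lambda>i. c * v i) g s = c * clifford u v g s"
  by (induction u v g s rule: clifford.induct) (simp_all add: algebra_simps)

lemma wedge_zero_vec [simp]: "wedge (\<lambda>_. 0) g s = 0"
  using clifford_scale_vec[of 0 "\<lambda>_. 0" "\<lambda>_. 0" g s] by simp

lemma wedge_sum_vec: "wedge (\<lambda>i. \<Sum>k\<in>A. c k * a k i) g s = (\<Sum>k\<in>A. c k * wedge (a k) g s)"
proof (induction A rule: infinite_finite_induct)
  case (insert k A)
  have "wedge (\<lambda>i. c k * a k i + (\<Sum>k\<in>A. c k * a k i)) g s
      = wedge (\<lambda>i. c k * a k i) g s + wedge (\<lambda>i. \<Sum>k\<in>A. c k * a k i) g s"
    using clifford_add_vec[of "\<lambda>_. 0" "\<lambda>_. 0" "\<lambda>i. c k * a k i" "\<lambda>i. \<Sum>k\<in>A. c k * a k i" g s] by simp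
  moreover have "wedge (\<lambda>i. c k * a k i) g s = c k * wedge (a k) g s"
    using clifford_scale_vec[of "c k" "\<lambda>_. 0" "a k" g s] by simp
  ultimately show ?case
    using insert by simp
qed simp_all

text \<open>In the recursion the terms mixing \<open>u 0\<close> or \<open>v 0\<close> with the tail
  operator cancel, because of the minus sign on strings starting with \<open>True\<close>;
  \<open>u 0 * v 0\<close> and the square for the tails remain.\<close>

lemma clifford_square:
  "clifford u v (clifford u v g) s = (\<Sum>i<length s. u i * v i) * g s"
  by (induction u v g s rule: clifford.induct)
    (simp_all add: clifford_add clifford_diff clifford_scale algebra_simps sum.lessThan_Suc_shift
       del: sum.lessThan_Suc)

lemma wedge_wedge [simp]: "wedge a (wedge a g) s = 0"
  by (simp add: clifford_square)

text \<open>Polarisation: expand the square for \<open>w\<close>, the sum of \<open>v\<close> and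
  \<open>a\<close>, and compare it with the square for \<open>v\<close>, using that
  \<open>wedge a\<close> squares to zero.\<close>

lemma clifford_wedge:
  "clifford u v (wedge a g) s = (\<Sum>i<length s. u i * a i) * g s - wedge a (clifford u v g) s"
proof -
  define w where "w = (\<lambda>i. v i + a i)"
  have split: "clifford u w h t = clifford u v h t + wedge a h t" for h t
    using clifford_add_vec[of u "\<lambda>_. 0" v a h t] by (simp add: w_def)
  have "clifford u w (clifford u w g) s = (\<Sum>i<length s. u i * w i) * g s"
    by (rule clifford_square)
  moreover have "clifford u w (clifford u w g) s = clifford u v (clifford u v g) s
      + clifford u v (wedge a g) s + wedge a (clifford u v g) s"
    unfolding split by (simp add: split clifford_add)
  ultimately show ?thesis
    by (simp add: clifford_square w_def algebra_simps sum.distrib)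
qed

text \<open>Each term of the operator at \<open>s\<close> evaluates \<open>g\<close> at a string
  differing from \<open>s\<close> in exactly one bit, hence of the other parity.\<close>

lemma clifford_parity:
  assumes "\<And>t. length t = length s \<Longrightarrow> odd (count_list t True) \<noteq> odd (count_list s True) \<Longrightarrow> g t = 0"
  shows "clifford u v g s = 0"
  using assms
  by (induction u v g s rule: clifford.induct) simp_all

section \<open>Suslin matrices as matrices of the Clifford operator\<close>

text \<open>The order is dictated by the Suslin blocks: for positive length, \<open>odd_bits\<close>
  is \<open>even_bits\<close> with the first bit flipped, position by position. Creating or removing
  the leading basis vector thus keeps positions, which makes the diagonal blocks scalar.\<close>

fun even_bits :: "nat \<Rightarrow> bool list list" and odd_bits :: "nat \<Rightarrow> bool list list" where
  "even_bits 0 = [[]]"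
| "even_bits (Suc d) = map (Cons False) (even_bits d) @ map (Cons True) (odd_bits d)"
| "odd_bits 0 = []"
| "odd_bits (Suc d) = map (Cons True) (even_bits d) @ map (Cons False) (odd_bits d)"

lemma in_set_bits:
  "s \<in> set (even_bits d) \<longleftrightarrow> length s = d \<and> even (count_list s True)"
  "s \<in> set (odd_bits d) \<longleftrightarrow> length s = d \<and> odd (count_list s True)"
proof (induction s arbitrary: d)
  case Nil
  { case 1 show ?case by (cases d) auto
  next
    case 2 show ?case by (cases d) auto }
next
  case (Cons b s)
  { case 1 show ?case by (cases d; cases b) (auto simp: Cons.IH)
  next
    case 2 show ?case by (cases d; cases b) (auto simp: Cons.IH) }
qed

lemma distinct_bits: "distinct (even_bits d)" "distinct (odd_bits d)"
  by (induction d) (auto simp: distinct_map)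

lemma length_bits:
  "length (even_bits (Suc d)) = 2 ^ d" "length (odd_bits (Suc d)) = 2 ^ d"
  by (induction d) auto

definition vec_on :: "'b list \<Rightarrow> ('b \<Rightarrow> 'a) \<Rightarrow> 'a vec" where
  "vec_on xs g = vec (length xs) (\<lambda>i. g (xs ! i))"

lemma vec_on_dim [simp]: "dim_vec (vec_on xs g) = length xs"
  and vec_on_index [simp]: "i < length xs \<Longrightarrow> vec_on xs g $ i = g (xs ! i)"
  by (simp_all add: vec_on_def)

lemma vec_on_carrier [simp]: "vec_on xs g \<in> carrier_vec (length xs)"
  by (rule carrier_vecI) simp

lemma vec_on_append: "vec_on (xs @ ys) g = vec_on xs g @\<^sub>v vec_on ys g"
  by (rule eq_vecI) (auto simp: nth_append)

lemma vec_on_map: "vec_on (map f xs) g = vec_on xs (\<lambda>x. g (f x))"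
  by (rule eq_vecI) auto

lemma suslin_carrier: "suslin (Suc k) u v \<in> carrier_mat (2 ^ k) (2 ^ k)"
  by (induction k arbitrary: u v) (auto simp: mult_2 intro!: four_block_carrier_mat)

lemma clifford_vec_tail:
  assumes "dim_vec u = Suc (length s)" "dim_vec v = Suc (length s)"
  shows "clifford (\<lambda>i. u $ Suc i) (\<lambda>i. v $ Suc i) g s = clifford (($) (vec_tail u)) (($) (vec_tail v)) g s"
  by (rule clifford_cong) (use assms in \<open>auto simp: vec_tail_def\<close>)

lemma four_block_mult_vec_on:
  fixes B :: "'a::comm_ring_1 mat" and xs ys :: "'b list"
  assumes "B \<in> carrier_mat N N" "C \<in> carrier_mat N N" "length xs = N" "length ys = N"
    and "B *\<^sub>v vec_on ys h = vec_on xs p" "C *\<^sub>v vec_on xs g = vec_on ys q"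
  shows "four_block_mat (a \<cdot>\<^sub>m 1\<^sub>m N) B C (d \<cdot>\<^sub>m 1\<^sub>m N) *\<^sub>v (vec_on xs g @\<^sub>v vec_on ys h)
      = vec_on xs (\<lambda>t. a * g t + p t) @\<^sub>v vec_on ys (\<lambda>t. q t + d * h t)"
proof -
  have scal: "(c \<cdot>\<^sub>m 1\<^sub>m N) *\<^sub>v vec_on zs f = vec_on zs (\<lambda>t. c * f t)"
    if "length zs = N" for c :: 'a and zs :: "'b list" and f
  proof (rule eq_vecI)
    fix i assume "i < dim_vec (vec_on zs (\<lambda>t. c * f t))"
    then show "((c \<cdot>\<^sub>m 1\<^sub>m N) *\<^sub>v vec_on zs f) $ i = vec_on zs (\<lambda>t. c * f t) $ i"
      using that vec_on_carrier[of zs f]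
      by (simp add: smult_scalar_prod_distrib[of _ N])
  qed (simp add: that)
  have add: "vec_on zs f + vec_on zs f' = vec_on zs (\<lambda>t. f t + f' t)"
    for zs :: "'b list" and f f' :: "'b \<Rightarrow> 'a"
    by (rule eq_vecI) auto
  have "four_block_mat (a \<cdot>\<^sub>m 1\<^sub>m N) B C (d \<cdot>\<^sub>m 1\<^sub>m N) *\<^sub>v (vec_on xs g @\<^sub>v vec_on ys h)
      = ((a \<cdot>\<^sub>m 1\<^sub>m N) *\<^sub>v vec_on xs g + B *\<^sub>v vec_on ys h)
        @\<^sub>v (C *\<^sub>v vec_on xs g + (d \<cdot>\<^sub>m 1\<^sub>m N) *\<^sub>v vec_on ys h)"
    by (rule four_block_mat_mult_vec)
      (use assms(1-4) vec_on_carrier[of xs g] vec_on_carrier[of ys h] in auto)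
  then show ?thesis
    unfolding assms(5,6) scal[OF assms(3)] scal[OF assms(4)] add .
qed

text \<open>Neither half carries an induction alone: the lower left block of \<open>suslin\<close>
  is a transpose with swapped arguments, and transposing the whole matrix brings back an
  untransposed block.\<close>

lemma suslin_mult_vec_on:
  assumes "dim_vec u = Suc k" "dim_vec v = Suc k"
  shows "suslin (Suc k) u v *\<^sub>v vec_on (odd_bits (Suc k)) g
      = vec_on (even_bits (Suc k)) (clifford (($) u) (($) v) g)
    \<and> transpose_mat (suslin (Suc k) v u) *\<^sub>v vec_on (even_bits (Suc k)) g
      = vec_on (odd_bits (Suc k)) (clifford (($) u) (($) v) g)"
  using assms
proof (induction k arbitrary: u v g)
  case 0
  show ?case
    by (auto simp: scalar_prod_def intro!: eq_vecI)
next
  case (Suc k)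
  have tails: "dim_vec (vec_tail u) = Suc k" "dim_vec (vec_tail v) = Suc k"
    using Suc.prems by (simp_all add: vec_tail_def)
  note IH = Suc.IH[OF tails]
  have S: "suslin (Suc k) x y \<in> carrier_mat (2 ^ k) (2 ^ k)" for x y :: "'a vec"
    by (rule suslin_carrier)
  define c where "c = clifford (($) (vec_tail u)) (($) (vec_tail v))"
  \<comment> \<open>\<open>clifford\<close> recurses with shifted functions, \<open>suslin\<close>
    with \<open>vec_tail\<close>; the two agree on strings of length \<open>Suc k\<close>. The
    second equation also puts the summands in the order in which the block rows produce
    them.\<close>
  have restr: "vec_on xs (\<lambda>t. e t + clifford (\<lambda>i. u $ Suc i) (\<lambda>i. v $ Suc i) h t)
        = vec_on xs (\<lambda>t. e t + c h t)"
      "vec_on xs (\<lambda>t. e t - clifford (\<lambda>i. u $ Suc i) (\<lambda>i. v $ Suc i) h t)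
        = vec_on xs (\<lambda>t. - c h t + e t)"
    if "xs = even_bits (Suc k) \<or> xs = odd_bits (Suc k)" for xs e h
  proof -
    have "clifford (\<lambda>i. u $ Suc i) (\<lambda>i. v $ Suc i) h t = c h t" if "t \<in> set xs" for t
      unfolding c_def using that \<open>xs = _ \<or> xs = _\<close> Suc.prems
      by (intro clifford_vec_tail) (auto simp: in_set_bits simp del: even_bits.simps odd_bits.simps)
    then show "vec_on xs (\<lambda>t. e t + clifford (\<lambda>i. u $ Suc i) (\<lambda>i. v $ Suc i) h t)
        = vec_on xs (\<lambda>t. e t + c h t)"
      "vec_on xs (\<lambda>t. e t - clifford (\<lambda>i. u $ Suc i) (\<lambda>i. v $ Suc i) h t)
        = vec_on xs (\<lambda>t. - c h t + e t)"
      by (auto intro!: eq_vecI)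
  qed
  have neg: "- A *\<^sub>v vec_on xs g = vec_on ys (\<lambda>t. - c g t)"
    if "A *\<^sub>v vec_on xs g = vec_on ys (c g)" "A \<in> carrier_mat (2 ^ k) (2 ^ k)" "length xs = 2 ^ k"
    for A xs ys g
  proof -
    have "- A *\<^sub>v vec_on xs g = - (A *\<^sub>v vec_on xs g)"
      using that by (intro uminus_mult_mat_vec) auto
    then show ?thesis
      unfolding that(1) by (auto intro!: eq_vecI)
  qed
  have IH_c: "suslin (Suc k) (vec_tail u) (vec_tail v) *\<^sub>v vec_on (odd_bits (Suc k)) h
        = vec_on (even_bits (Suc k)) (c h)"
      "transpose_mat (suslin (Suc k) (vec_tail v) (vec_tail u)) *\<^sub>v vec_on (even_bits (Suc k)) h
        = vec_on (odd_bits (Suc k)) (c h)" for h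
    using IH[of h] by (simp_all only: c_def)
  have "suslin (Suc (Suc k)) u v *\<^sub>v vec_on (odd_bits (Suc (Suc k))) g
      = vec_on (even_bits (Suc k)) (\<lambda>t. u $ 0 * g (True # t) + c (\<lambda>t. g (False # t)) t)
        @\<^sub>v vec_on (odd_bits (Suc k)) (\<lambda>t. - c (\<lambda>t. g (True # t)) t + v $ 0 * g (False # t))"
    unfolding odd_bits.simps(2)[of "Suc k"] suslin.simps(2) vec_on_append vec_on_map
    by (rule four_block_mult_vec_on)
      (use S length_bits[of k] in \<open>auto intro!: neg simp: IH_c simp del: even_bits.simps odd_bits.simps\<close>)
  also have "\<dots> = vec_on (even_bits (Suc (Suc k))) (clifford (($) u) (($) v) g)"
    unfolding even_bits.simps(2)[of "Suc k"] vec_on_append vec_on_map clifford.simps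
    by (simp only: restr simp_thms)
  finally have 1: "suslin (Suc (Suc k)) u v *\<^sub>v vec_on (odd_bits (Suc (Suc k))) g
      = vec_on (even_bits (Suc (Suc k))) (clifford (($) u) (($) v) g)" .
  have scalar_tr: "transpose_mat (x \<cdot>\<^sub>m 1\<^sub>m N) = x \<cdot>\<^sub>m 1\<^sub>m N" for x :: 'a and N
    by (rule eq_matI) auto
  \<comment> \<open>Transposition moves the minus sign to the upper right block, whose output lies
    on the strings starting with \<open>True\<close>, where \<open>clifford\<close> has its
    sign.\<close>
  have tr: "transpose_mat (suslin (Suc (Suc k)) v u) =
     four_block_mat (v $ 0 \<cdot>\<^sub>m 1\<^sub>m (2 ^ k)) (- suslin (Suc k) (vec_tail u) (vec_tail v))
       (transpose_mat (suslin (Suc k) (vec_tail v) (vec_tail u))) (u $ 0 \<cdot>\<^sub>m 1\<^sub>m (2 ^ k))"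
    unfolding suslin.simps(2)
    by (subst transpose_four_block_mat)
      (use S in \<open>auto simp: transpose_uminus scalar_tr\<close>)
  have "transpose_mat (suslin (Suc (Suc k)) v u) *\<^sub>v vec_on (even_bits (Suc (Suc k))) g
      = vec_on (even_bits (Suc k)) (\<lambda>t. v $ 0 * g (False # t) + - c (\<lambda>t. g (True # t)) t)
        @\<^sub>v vec_on (odd_bits (Suc k)) (\<lambda>t. c (\<lambda>t. g (False # t)) t + u $ 0 * g (True # t))"
    unfolding even_bits.simps(2)[of "Suc k"] tr vec_on_append vec_on_map
    by (rule four_block_mult_vec_on)
      (use S length_bits[of k] in \<open>auto intro!: neg simp: IH_c simp del: even_bits.simps odd_bits.simps\<close>)
  also have "\<dots> = vec_on (odd_bits (Suc (Suc k))) (clifford (($) u) (($) v) g)"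
    unfolding odd_bits.simps(2)[of "Suc k"] vec_on_append vec_on_map clifford.simps
    by (simp only: restr simp_thms add.commute)
  finally show ?case
    using 1 by blast
qed

section \<open>The tensor algebra\<close>

text \<open>The linear extension of values \<open>F\<close> prescribed on basis words. For infinite
  support the sum takes the default value 0, so additivity needs finiteness assumptions.\<close>

definition lin_ext :: "('w \<Rightarrow> 'a) \<Rightarrow> ('w \<Rightarrow> 'a::comm_ring_1) \<Rightarrow> 'a" where
  "lin_ext F x = (\<Sum>w | x w \<noteq> 0. x w * F w)"

lemma lin_ext_superset:
  assumes "finite A" "{w. x w \<noteq> 0} \<subseteq> A"
  shows "lin_ext F x = (\<Sum>w\<in>A. x w * F w)"
  unfolding lin_ext_def by (rule sum.mono_neutral_left) (use assms in auto)

lemma lin_ext_add: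
  assumes "finite {w. x w \<noteq> 0}" "finite {w. y w \<noteq> 0}"
  shows "lin_ext F (\<lambda>w. x w + y w) = lin_ext F x + lin_ext F y"
proof -
  let ?A = "{w. x w \<noteq> 0} \<union> {w. y w \<noteq> 0}"
  have "lin_ext F (\<lambda>w. x w + y w) = (\<Sum>w\<in>?A. (x w + y w) * F w)"
    by (rule lin_ext_superset) (use assms in auto)
  moreover have "lin_ext F x = (\<Sum>w\<in>?A. x w * F w)" "lin_ext F y = (\<Sum>w\<in>?A. y w * F w)"
    by (rule lin_ext_superset; use assms in auto)+
  ultimately show ?thesis
    by (simp add: sum.distrib distrib_right)
qed

lemma lin_ext_scale:
  assumes "finite {w. x w \<noteq> 0}"
  shows "lin_ext F (\<lambda>w. c * x w) = c * lin_ext F x"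
proof -
  have "lin_ext F (\<lambda>w. c * x w) = (\<Sum>w | x w \<noteq> 0. (c * x w) * F w)"
    by (rule lin_ext_superset) (use assms in auto)
  then show ?thesis
    by (simp add: lin_ext_def sum_distrib_left mult.assoc)
qed

lemma lin_ext_zero [simp]: "lin_ext F (\<lambda>_. 0) = 0"
  by (simp add: lin_ext_def)

lemma lin_ext_zero_fun [simp]: "lin_ext (\<lambda>_. 0) x = 0"
  by (simp add: lin_ext_def)

lemma finite_supp_add:
  assumes "finite {w. x w \<noteq> 0}" "finite {w. y w \<noteq> 0}"
  shows "finite {w. x w + y w \<noteq> (0::'a::comm_ring_1)}"
  by (rule finite_subset[OF _ finite_UnI[OF assms]]) auto

lemma finite_supp_scale:
  "finite {w. x w \<noteq> 0} \<Longrightarrow> finite {w. c * x w \<noteq> (0::'a::comm_ring_1)}"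
  by (rule finite_subset[rotated]) auto

lemma finite_supp_sum:
  assumes "\<And>k. k \<in> A \<Longrightarrow> finite {w. x k w \<noteq> 0}"
  shows "finite {w. (\<Sum>k\<in>A. x k w) \<noteq> (0::'a::comm_ring_1)}"
  using assms by (induction A rule: infinite_finite_induct) (auto intro: finite_supp_add)

lemma lin_ext_sum:
  assumes "\<And>k. k \<in> A \<Longrightarrow> finite {w. x k w \<noteq> 0}"
  shows "lin_ext F (\<lambda>w. \<Sum>k\<in>A. x k w) = (\<Sum>k\<in>A. lin_ext F (x k))"
  using assms
  by (induction A rule: infinite_finite_induct) (auto simp: lin_ext_add finite_supp_sum)

definition single :: "'w \<Rightarrow> 'w \<Rightarrow> 'a::comm_ring_1" where
  "single w = (\<lambda>u. if u = w then 1 else 0)"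

lemma finite_supp_single [simp]: "finite {u. single w u \<noteq> (0::'a::comm_ring_1)}"
  by (simp add: single_def)

lemma lin_ext_single [simp]: "lin_ext F (single w) = F w"
proof -
  have "lin_ext F (single w) = (\<Sum>u\<in>{w}. single w u * F u)"
    by (rule lin_ext_superset) (auto simp: single_def)
  then show ?thesis by (simp add: single_def)
qed

text \<open>Coefficients are themselves linear functionals, so identities between tensors can be
  checked through \<open>lin_ext\<close>.\<close>

lemma lin_ext_delta:
  assumes "finite {w. x w \<noteq> 0}"
  shows "lin_ext (\<lambda>w. if w = u then 1 else 0) x = x u"
  using assms by (simp add: lin_ext_def if_distrib[of "\<lambda>t. _ * t"] cong: if_cong)

text \<open>Cut positions of \<open>u\<close> correspond bijectively to factorisations
  \<open>u = p @ q\<close>, which turns the convolution into a double sum over supports.\<close>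

lemma tensor_mult_conv:
  assumes "finite {w. x w \<noteq> 0}" "finite {w. y w \<noteq> 0}"
  shows "tensor_mult x y u = (\<Sum>p | x p \<noteq> 0. \<Sum>q | y q \<noteq> 0. if p @ q = u then x p * y q else 0)"
proof -
  let ?S = "{(p, q). p @ q = u}"
  have "(p, q) \<in> (\<lambda>k. (take k u, drop k u)) ` {..length u}" if "p @ q = u" for p q
    by (rule image_eqI[of _ _ "length p"]) (use that in auto)
  then have S: "?S = (\<lambda>k. (take k u, drop k u)) ` {..length u}"
    by auto
  have inj: "inj_on (\<lambda>k. (take k u, drop k u)) {..length u}"
    by (rule inj_on_inverseI[of _ "\<lambda>(p, q). length p"]) simp
  have "tensor_mult x y u = (\<Sum>(p, q)\<in>?S. x p * y q)"
    unfolding tensor_mult_def S by (simp add: sum.reindex[OF inj])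
  also have "\<dots> = (\<Sum>(p, q)\<in>{p. x p \<noteq> 0} \<times> {q. y q \<noteq> 0}. if p @ q = u then x p * y q else 0)"
  proof (rule sum.mono_neutral_cong)
    show "finite ?S" unfolding S by simp
  qed (use assms in auto)
  finally show ?thesis
    by (simp add: sum.cartesian_product)
qed

lemma supp_tensor_mult:
  "{w. tensor_mult x y w \<noteq> 0} \<subseteq> (\<lambda>(p, q). p @ q) ` ({w. x w \<noteq> 0} \<times> {w. y w \<noteq> 0})"
proof
  fix w assume "w \<in> {w. tensor_mult x y w \<noteq> 0}"
  then have "(\<Sum>k\<le>length w. x (take k w) * y (drop k w)) \<noteq> 0"
    by (simp add: tensor_mult_def)
  then obtain k where "x (take k w) * y (drop k w) \<noteq> 0"
    by (rule sum.not_neutral_contains_not_neutral)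
  then have "x (take k w) \<noteq> 0" "y (drop k w) \<noteq> 0"
    by auto
  then show "w \<in> (\<lambda>(p, q). p @ q) ` ({w. x w \<noteq> 0} \<times> {w. y w \<noteq> 0})"
    by (intro image_eqI[of _ _ "(take k w, drop k w)"]) auto
qed

lemma finite_supp_tensor_mult:
  assumes "finite {w. x w \<noteq> 0}" "finite {w. y w \<noteq> 0}"
  shows "finite {w. tensor_mult x y w \<noteq> 0}"
  by (rule finite_subset[OF supp_tensor_mult]) (use assms in auto)

text \<open>The universal form of "bilinear extension of concatenation"; associativity and the
  multiplicativity of \<open>rep\<close> both reduce to it.\<close>

lemma lin_ext_tensor_mult:
  assumes fin: "finite {w. x w \<noteq> 0}" "finite {w. y w \<noteq> 0}"
  shows "lin_ext F (tensor_mult x y) = lin_ext (\<lambda>p. lin_ext (\<lambda>q. F (p @ q)) y) x"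
proof -
  let ?X = "{w. x w \<noteq> 0}" and ?Y = "{w. y w \<noteq> 0}"
  let ?Z = "(\<lambda>(p, q). p @ q) ` (?X \<times> ?Y)"
  have "lin_ext F (tensor_mult x y) = (\<Sum>u\<in>?Z. tensor_mult x y u * F u)"
    by (rule lin_ext_superset) (use supp_tensor_mult[of x y] fin in auto)
  also have "\<dots> = (\<Sum>u\<in>?Z. \<Sum>p\<in>?X. \<Sum>q\<in>?Y. if p @ q = u then x p * y q * F u else 0)"
    unfolding tensor_mult_conv[OF fin] sum_distrib_right by (intro sum.cong refl) simp
  also have "\<dots> = (\<Sum>p\<in>?X. \<Sum>q\<in>?Y. \<Sum>u\<in>?Z. if p @ q = u then x p * y q * F u else 0)"
    by (subst sum.swap, rule sum.cong[OF refl], subst sum.swap) simp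
  also have "\<dots> = (\<Sum>p\<in>?X. \<Sum>q\<in>?Y. x p * y q * F (p @ q))"
  proof (intro sum.cong refl)
    fix p q assume "p \<in> ?X" "q \<in> ?Y"
    then have "p @ q \<in> ?Z" by auto
    moreover have "finite ?Z" using fin by auto
    ultimately show "(\<Sum>u\<in>?Z. if p @ q = u then x p * y q * F u else 0) = x p * y q * F (p @ q)"
      by simp
  qed
  finally show ?thesis
    by (simp add: lin_ext_def sum_distrib_left mult.assoc)
qed

lemma tensor_one_eq: "tensor_one = single []"
  by (auto simp: tensor_one_def single_def)

lemma tensor_mult_single_single:
  "tensor_mult (single p) (single q) = (single (p @ q) :: nat list \<Rightarrow> 'a::comm_ring_1)"
proof
  fix u :: "nat list"
  have "tensor_mult (single p) (single q) u
      = lin_ext (\<lambda>w. if w = u then 1 else 0) (tensor_mult (single p) (single q :: _ \<Rightarrow> 'a))"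
    by (rule lin_ext_delta[symmetric]) (simp add: finite_supp_tensor_mult)
  then show "tensor_mult (single p) (single q) u = (single (p @ q) u :: 'a)"
    by (simp add: lin_ext_tensor_mult) (simp add: single_def)
qed

lemma tensor_mult_add_left:
  "tensor_mult (\<lambda>w. x w + y w) z = (\<lambda>w. tensor_mult x z w + tensor_mult y z w)"
  by (simp add: tensor_mult_def distrib_right sum.distrib)

lemma tensor_mult_add_right:
  "tensor_mult z (\<lambda>w. x w + y w) = (\<lambda>w. tensor_mult z x w + tensor_mult z y w)"
  by (simp add: tensor_mult_def distrib_left sum.distrib)

lemma tensor_mult_scale_left: "tensor_mult (\<lambda>w. c * x w) y = (\<lambda>w. c * tensor_mult x y w)"
  by (simp add: tensor_mult_def sum_distrib_left mult.assoc)

lemma tensor_mult_scale_right: "tensor_mult x (\<lambda>w. c * y w) = (\<lambda>w. c * tensor_mult x y w)"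
  by (simp add: tensor_mult_def sum_distrib_left mult.left_commute)

lemma tensor_mult_diff_right:
  "tensor_mult z (\<lambda>w. x w - y w) = (\<lambda>w. tensor_mult z x w - tensor_mult z y w)"
  by (simp add: tensor_mult_def right_diff_distrib sum_subtractf)

lemma tensor_mult_one_left: "tensor_mult tensor_one x = x"
proof
  fix w
  have "tensor_mult tensor_one x w = (\<Sum>k\<in>{0}. tensor_one (take k w) * x (drop k w))"
    unfolding tensor_mult_def
    by (rule sum.mono_neutral_right) (auto simp: tensor_one_def)
  then show "tensor_mult tensor_one x w = x w"
    by (simp add: tensor_one_def)
qed

lemma tensor_mult_one_right: "tensor_mult x tensor_one = x"
proof
  fix w
  have "tensor_mult x tensor_one w = (\<Sum>k\<in>{length w}. x (take k w) * tensor_one (drop k w))"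
    unfolding tensor_mult_def
    by (rule sum.mono_neutral_right) (auto simp: tensor_one_def)
  then show "tensor_mult x tensor_one w = x w"
    by (simp add: tensor_one_def)
qed

lemma tensor_mult_assoc:
  assumes "finite {w. x w \<noteq> 0}" "finite {w. y w \<noteq> 0}" "finite {w. z w \<noteq> 0}"
  shows "tensor_mult (tensor_mult x y) z = tensor_mult x (tensor_mult y z)"
proof
  fix u
  note fin = assms finite_supp_tensor_mult
  have "tensor_mult (tensor_mult x y) z u
      = lin_ext (\<lambda>w. if w = u then 1 else 0) (tensor_mult (tensor_mult x y) z)"
    by (rule lin_ext_delta[symmetric]) (simp add: fin)
  also have "\<dots> = lin_ext (\<lambda>w. if w = u then 1 else 0) (tensor_mult x (tensor_mult y z))"
    by (simp add: lin_ext_tensor_mult fin)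
  also have "\<dots> = tensor_mult x (tensor_mult y z) u"
    by (rule lin_ext_delta) (simp add: fin)
  finally show "tensor_mult (tensor_mult x y) z u = tensor_mult x (tensor_mult y z) u" .
qed

section \<open>The tensor algebra as a ring\<close>

definition tensors :: "nat \<Rightarrow> (nat list \<Rightarrow> 'a::comm_ring_1) set" where
  "tensors m = {x. finite {w. x w \<noteq> 0} \<and> (\<forall>w. x w \<noteq> 0 \<longrightarrow> set w \<subseteq> {..<m})}"

lemma tensor_algebra_simps [simp]:
  "carrier (tensor_algebra m) = tensors m"
  "mult (tensor_algebra m) = tensor_mult"
  "one (tensor_algebra m) = tensor_one"
  "zero (tensor_algebra m) = (\<lambda>w. 0)"
  "add (tensor_algebra m) = (\<lambda>x y w. x w + y w)"
  "smult (tensor_algebra m) = (\<lambda>c x w. c * x w)"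
  by (simp_all add: tensor_algebra_def tensors_def)

lemma finite_supp_tensors: "x \<in> tensors m \<Longrightarrow> finite {w. x w \<noteq> 0}"
  by (simp add: tensors_def)

lemma tensors_zero: "(\<lambda>_. 0) \<in> tensors m"
  by (simp add: tensors_def)

lemma tensors_add:
  assumes "x \<in> tensors m" "y \<in> tensors m"
  shows "(\<lambda>w. x w + y w) \<in> tensors m"
proof -
  have "set w \<subseteq> {..<m}" if "x w + y w \<noteq> 0" for w
    using assms that unfolding tensors_def by (cases "x w = 0") auto
  with assms finite_supp_add[of x y] show ?thesis
    unfolding tensors_def by blast
qed

lemma tensors_scale:
  assumes "x \<in> tensors m"
  shows "(\<lambda>w. c * x w) \<in> tensors m"
proof -
  have "set w \<subseteq> {..<m}" if "c * x w \<noteq> 0" for w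
    using assms that unfolding tensors_def by (cases "x w = 0") auto
  with assms finite_supp_scale[of x] show ?thesis
    unfolding tensors_def by blast
qed

lemma tensors_minus: "x \<in> tensors m \<Longrightarrow> (\<lambda>w. - x w) \<in> tensors m"
  using tensors_scale[of x m "-1"] by simp

lemma tensors_diff: "x \<in> tensors m \<Longrightarrow> y \<in> tensors m \<Longrightarrow> (\<lambda>w. x w - y w) \<in> tensors m"
  using tensors_add[of x m "\<lambda>w. - y w"] tensors_minus[of y m] by simp

lemma tensors_sum:
  "(\<And>k. k \<in> A \<Longrightarrow> x k \<in> tensors m) \<Longrightarrow> (\<lambda>w. \<Sum>k\<in>A. x k w) \<in> tensors m"
  by (induction A rule: infinite_finite_induct) (simp_all add: tensors_zero tensors_add)

lemma tensors_mult:
  assumes "x \<in> tensors m" "y \<in> tensors m"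
  shows "tensor_mult x y \<in> tensors m"
  unfolding tensors_def
proof (intro CollectI conjI allI impI)
  show "finite {w. tensor_mult x y w \<noteq> 0}"
    using assms by (simp add: finite_supp_tensor_mult tensors_def)
  fix w assume "tensor_mult x y w \<noteq> 0"
  then obtain p q where "w = p @ q" "x p \<noteq> 0" "y q \<noteq> 0"
    using supp_tensor_mult[of x y] by auto
  then show "set w \<subseteq> {..<m}"
    using assms by (auto simp: tensors_def)
qed

lemma tensors_single: "set w \<subseteq> {..<m} \<Longrightarrow> single w \<in> tensors m"
  by (auto simp: tensors_def single_def)

lemma tensors_one: "tensor_one \<in> tensors m"
  by (simp add: tensor_one_eq tensors_single)

lemma ring_tensor_algebra: "ring (tensor_algebra m :: ('a::comm_ring_1, _) module)"
proof (rule ringI)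
  show "abelian_group (tensor_algebra m :: ('a, _) module)"
  proof (rule abelian_groupI)
    fix x :: "nat list \<Rightarrow> 'a" assume "x \<in> carrier (tensor_algebra m)"
    then show "\<exists>y\<in>carrier (tensor_algebra m). y \<oplus>\<^bsub>tensor_algebra m\<^esub> x = \<zero>\<^bsub>tensor_algebra m\<^esub>"
      by (intro bexI[of _ "\<lambda>w. - x w"]) (auto intro: tensors_minus)
  qed (auto intro: tensors_add tensors_zero simp: add.assoc add.commute)
  show "Group.monoid (tensor_algebra m :: ('a, _) module)"
    by (rule monoidI)
      (auto intro: tensors_mult tensors_one
        simp: tensor_mult_one_left tensor_mult_one_right tensor_mult_assoc finite_supp_tensors)
qed (auto simp: tensor_mult_add_left tensor_mult_add_right)

lemma supp_tensor_of_vec: "{w. tensor_of_vec v w \<noteq> 0} \<subseteq> (\<lambda>i. [i]) ` {..<dim_vec v}"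
proof
  fix w assume "w \<in> {w. tensor_of_vec v w \<noteq> 0}"
  then show "w \<in> (\<lambda>i. [i]) ` {..<dim_vec v}"
    by (cases w; cases "tl w") (auto simp: tensor_of_vec_def split: if_splits)
qed

lemma lin_ext_tensor_of_vec:
  assumes "v \<in> carrier_vec m"
  shows "lin_ext F (tensor_of_vec v) = (\<Sum>i<m. v $ i * F [i])"
proof -
  have "lin_ext F (tensor_of_vec v) = (\<Sum>w\<in>(\<lambda>i. [i]) ` {..<m}. tensor_of_vec v w * F w)"
    by (rule lin_ext_superset) (use assms supp_tensor_of_vec[of v] in auto)
  then show ?thesis
    using assms by (simp add: sum.reindex inj_on_def tensor_of_vec_def)
qed

lemma tensors_of_vec:
  assumes "v \<in> carrier_vec m" shows "tensor_of_vec v \<in> tensors m"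
proof -
  have supp: "{w. tensor_of_vec v w \<noteq> 0} \<subseteq> (\<lambda>i. [i]) ` {..<m}"
    using assms supp_tensor_of_vec[of v] by simp
  then have "finite {w. tensor_of_vec v w \<noteq> 0}"
    by (rule finite_subset) simp
  with supp show ?thesis
    unfolding tensors_def by auto
qed

lemma tensor_of_vec_add:
  "dim_vec u = dim_vec v \<Longrightarrow> tensor_of_vec (u + v) = (\<lambda>w. tensor_of_vec u w + tensor_of_vec v w)"
  by (auto simp: tensor_of_vec_def split: list.splits)

lemma tensor_of_unit_vec: "i < m \<Longrightarrow> tensor_of_vec (unit_vec m i) = single [i]"
  by (auto simp: tensor_of_vec_def single_def split: list.splits)

section \<open>Wedge representations and the exterior ideal\<close>

abbreviation wedges ::
    "(nat \<Rightarrow> nat \<Rightarrow> 'a::comm_ring_1) \<Rightarrow> nat list \<Rightarrow> (bool list \<Rightarrow> 'a) \<Rightarrow> bool list \<Rightarrow> 'a" where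
  "wedges a w g \<equiv> foldr (\<lambda>i. wedge (a i)) w g"

text \<open>Letter \<open>i\<close> acts as left multiplication by the vector with coordinates
  \<open>a i k\<close>; words act from right to left.\<close>

definition rep ::
    "(nat \<Rightarrow> nat \<Rightarrow> 'a::comm_ring_1) \<Rightarrow> (nat list \<Rightarrow> 'a) \<Rightarrow> (bool list \<Rightarrow> 'a) \<Rightarrow> bool list \<Rightarrow> 'a" where
  "rep a x g = (\<lambda>s. lin_ext (\<lambda>w. wedges a w g s) x)"

lemma wedges_cong:
  assumes "\<And>t. length t = length s \<Longrightarrow> g t = h t"
    and "\<And>i k. i \<in> set w \<Longrightarrow> k < length s \<Longrightarrow> a i k = b i k"
  shows "wedges a w g s = wedges b w h s"
  using assms
proof (induction w arbitrary: s)
  case (Cons i w)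
  show ?case
    unfolding foldr.simps o_apply
    by (rule clifford_cong) (auto intro!: Cons.IH simp: Cons.prems)
qed simp

lemma wedges_lin:
  "wedges a w (\<lambda>t. \<Sum>k\<in>A. c k * f k t) s = (\<Sum>k\<in>A. c k * wedges a w (f k) s)"
proof (induction w arbitrary: s)
  case (Cons i w)
  have "wedges a w (\<lambda>t. \<Sum>k\<in>A. c k * f k t) = (\<lambda>s. \<Sum>k\<in>A. c k * wedges a w (f k) s)"
    by (rule ext) (rule Cons.IH)
  then show ?case
    by (simp add: clifford_sum clifford_scale)
qed simp

lemma rep_tensor_mult:
  assumes "x \<in> tensors m" "y \<in> tensors m"
  shows "rep a (tensor_mult x y) g = rep a x (rep a y g)"
proof
  fix s
  have "rep a (tensor_mult x y) g s = lin_ext (\<lambda>p. lin_ext (\<lambda>q. wedges a p (wedges a q g) s) y) x"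
    using assms by (simp add: rep_def lin_ext_tensor_mult finite_supp_tensors)
  also have "(\<lambda>p. lin_ext (\<lambda>q. wedges a p (wedges a q g) s) y) = (\<lambda>p. wedges a p (rep a y g) s)"
    by (simp add: rep_def lin_ext_def wedges_lin)
  finally show "rep a (tensor_mult x y) g s = rep a x (rep a y g) s"
    by (simp add: rep_def)
qed

lemma rep_add:
  "x \<in> tensors m \<Longrightarrow> y \<in> tensors m \<Longrightarrow> rep a (\<lambda>w. x w + y w) g s = rep a x g s + rep a y g s"
  by (simp add: rep_def lin_ext_add finite_supp_tensors)

lemma rep_scale: "x \<in> tensors m \<Longrightarrow> rep a (\<lambda>w. c * x w) g s = c * rep a x g s"
  by (simp add: rep_def lin_ext_scale finite_supp_tensors)

lemma rep_minus: "x \<in> tensors m \<Longrightarrow> rep a (\<lambda>w. - x w) g s = - rep a x g s"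
  using rep_scale[of x m a "-1" g s] by simp

lemma rep_diff:
  "x \<in> tensors m \<Longrightarrow> y \<in> tensors m \<Longrightarrow> rep a (\<lambda>w. x w - y w) g s = rep a x g s - rep a y g s"
  using rep_add[of x m "\<lambda>w. - y w" a g s] by (simp add: rep_minus[of _ m] tensors_minus)

lemma rep_sum:
  "(\<And>k. k \<in> A \<Longrightarrow> x k \<in> tensors m) \<Longrightarrow>
    rep a (\<lambda>w. \<Sum>k\<in>A. x k w) g s = (\<Sum>k\<in>A. rep a (x k) g s)"
  unfolding rep_def by (rule lin_ext_sum) (use finite_supp_tensors in blast)

lemma rep_single [simp]: "rep a (single w) g = wedges a w g"
  by (simp add: rep_def)

lemma rep_one [simp]: "rep a tensor_one g = g"
  by (simp add: tensor_one_eq)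

lemma rep_zero_right: "rep a x (\<lambda>_. 0) = (\<lambda>_. 0)"
  \<comment> \<open>A sum over the empty index set is the zero function, so linearity gives
    preservation of zero.\<close>
  using wedges_lin[of a _ "\<lambda>_. 0" "\<lambda>_. undefined" "{}"] by (simp add: rep_def)

lemma rep_tensor_of_vec:
  assumes "v \<in> carrier_vec m"
  shows "rep a (tensor_of_vec v) g = wedge (\<lambda>k. \<Sum>i<m. v $ i * a i k) g"
  by (rule ext) (simp add: rep_def lin_ext_tensor_of_vec[OF assms] wedge_sum_vec)

text \<open>Absorption on both sides comes from multiplicativity of \<open>rep\<close>. By
  minimality of the generated ideal it then suffices to check the generators.\<close>

lemma ideal_kernel_rep:
  "ideal {x \<in> tensors m. \<forall>g s. rep a x g s = 0} (tensor_algebra m :: ('a::comm_ring_1, _) module)"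
    (is "ideal ?K ?T")
proof (rule idealI[OF ring_tensor_algebra])
  interpret T: ring ?T by (rule ring_tensor_algebra)
  show "subgroup ?K (add_monoid ?T)"
  proof (rule T.add.subgroupI)
    show "\<ominus>\<^bsub>?T\<^esub> x \<in> ?K" if "x \<in> ?K" for x
    proof -
      have "\<ominus>\<^bsub>?T\<^esub> x = (\<lambda>w. - x w)"
        by (rule T.minus_equality) (use that in \<open>auto intro: tensors_minus\<close>)
      with that show ?thesis
        by (auto simp: tensors_minus rep_minus[of _ m])
    qed
  next
    show "?K \<noteq> {}"
      using tensors_zero by (auto simp: rep_def intro!: exI[of _ "\<lambda>_. 0"])
  qed (auto intro: tensors_add simp: rep_add[of _ m])
next
  fix x y assume xy: "x \<in> ?K" "y \<in> carrier ?T"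
  then have x: "rep a x = (\<lambda>_ _. 0)" by auto
  show "y \<otimes>\<^bsub>?T\<^esub> x \<in> ?K" "x \<otimes>\<^bsub>?T\<^esub> y \<in> ?K"
    using xy by (auto simp: rep_tensor_mult[of _ m] tensors_mult x rep_zero_right)
qed

lemma ideal_ext_ideal: "ideal (ext_ideal m) (tensor_algebra m)"
  unfolding ext_ideal_def
  by (rule ring.genideal_ideal[OF ring_tensor_algebra])
    (auto intro: tensors_mult tensors_of_vec)

lemma square_in_ext_ideal:
  assumes "v \<in> carrier_vec m"
  shows "tensor_mult (tensor_of_vec v) (tensor_of_vec v) \<in> ext_ideal m"
proof -
  have "{tensor_mult (tensor_of_vec v) (tensor_of_vec v) | v. v \<in> carrier_vec m} \<subseteq> ext_ideal m"
    unfolding ext_ideal_def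
    by (rule ring.genideal_self[OF ring_tensor_algebra]) (auto intro: tensors_mult tensors_of_vec)
  with assms show ?thesis by blast
qed

lemma rep_ext_ideal:
  assumes "x \<in> ext_ideal m"
  shows "rep a x g s = 0"
proof -
  have "ext_ideal m \<subseteq> {x \<in> tensors m. \<forall>g s. rep a x g s = 0}"
    unfolding ext_ideal_def
  proof (rule ring.genideal_minimal[OF ring_tensor_algebra ideal_kernel_rep], safe)
    fix v :: "'a vec" assume v: "v \<in> carrier_vec m"
    show "tensor_mult (tensor_of_vec v) (tensor_of_vec v) \<in> tensors m"
      by (intro tensors_mult tensors_of_vec v)
    fix g s
    show "rep a (tensor_mult (tensor_of_vec v) (tensor_of_vec v)) g s = 0"
      using v by (simp add: rep_tensor_mult[of _ m] tensors_of_vec rep_tensor_of_vec)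
  qed
  with assms show ?thesis by blast
qed

lemma ext_ideal_tensors: "x \<in> ext_ideal m \<Longrightarrow> x \<in> tensors m"
  using ideal.Icarr[OF ideal_ext_ideal] by auto

lemma ext_ideal_zero: "(\<lambda>_. 0) \<in> ext_ideal m"
  using additive_subgroup.zero_closed[OF ideal.axioms(1)[OF ideal_ext_ideal[of m]]] by simp

lemma ext_ideal_add: "x \<in> ext_ideal m \<Longrightarrow> y \<in> ext_ideal m \<Longrightarrow> (\<lambda>w. x w + y w) \<in> ext_ideal m"
  using additive_subgroup.a_closed[OF ideal.axioms(1)[OF ideal_ext_ideal[of m]], of x y] by simp

lemma ext_ideal_mult_left:
  "x \<in> ext_ideal m \<Longrightarrow> y \<in> tensors m \<Longrightarrow> tensor_mult y x \<in> ext_ideal m"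
  using ideal.I_l_closed[OF ideal_ext_ideal[of m], of x y] by simp

lemma ext_ideal_mult_right:
  "x \<in> ext_ideal m \<Longrightarrow> y \<in> tensors m \<Longrightarrow> tensor_mult x y \<in> ext_ideal m"
  using ideal.I_r_closed[OF ideal_ext_ideal[of m], of x y] by simp

text \<open>\<open>Idl\<close> is closed under the ring operations; scaling by \<open>c\<close> is
  brought in as multiplication by \<open>c\<close> times the unit tensor.\<close>

lemma ext_ideal_scale: "x \<in> ext_ideal m \<Longrightarrow> (\<lambda>w. c * x w) \<in> ext_ideal m"
  using ext_ideal_mult_left[of x m "\<lambda>w. c * tensor_one w"]
  by (simp add: tensors_scale tensors_one tensor_mult_scale_left tensor_mult_one_left)

lemma ext_ideal_diff: "x \<in> ext_ideal m \<Longrightarrow> y \<in> ext_ideal m \<Longrightarrow> (\<lambda>w. x w - y w) \<in> ext_ideal m"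
  using ext_ideal_add[of x m "\<lambda>w. -1 * y w"] ext_ideal_scale[of y m "-1"] by simp

lemma ext_ideal_sum:
  "(\<And>k. k \<in> A \<Longrightarrow> x k \<in> ext_ideal m) \<Longrightarrow> (\<lambda>w. \<Sum>k\<in>A. x k w) \<in> ext_ideal m"
  by (induction A rule: infinite_finite_induct) (simp_all add: ext_ideal_zero ext_ideal_add)

section \<open>Normal forms of words modulo the exterior ideal\<close>

lemma single_square_in_ext_ideal:
  assumes "i < m" "set r \<subseteq> {..<m}"
  shows "(single (i # i # r) :: _ \<Rightarrow> 'a::comm_ring_1) \<in> ext_ideal m"
proof -
  have "tensor_mult (single [i]) (single [i] :: _ \<Rightarrow> 'a) \<in> ext_ideal m"
    using square_in_ext_ideal[of "unit_vec m i" m] assms by (simp add: tensor_of_unit_vec)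
  from ext_ideal_mult_right[OF this tensors_single[OF assms(2)]] show ?thesis
    by (simp add: tensor_mult_single_single)
qed

text \<open>Expand the square of the sum of two unit vectors and subtract their own squares.\<close>

lemma single_swap_in_ext_ideal:
  assumes "i < m" "j < m" "set r \<subseteq> {..<m}"
  shows "(\<lambda>w. single (i # j # r) w + single (j # i # r) w :: 'a::comm_ring_1) \<in> ext_ideal m"
proof -
  let ?e = "\<lambda>i. single [i] :: nat list \<Rightarrow> 'a"
  have "tensor_mult (\<lambda>w. ?e i w + ?e j w) (\<lambda>w. ?e i w + ?e j w) \<in> ext_ideal m"
    using square_in_ext_ideal[of "unit_vec m i + unit_vec m j" m] assms
    by (simp add: tensor_of_unit_vec tensor_of_vec_add)
  from ext_ideal_mult_right[OF this tensors_single[OF assms(3)]]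
  have "(\<lambda>w. single (i # i # r) w + single (i # j # r) w
      + (single (j # i # r) w + single (j # j # r) w) :: 'a) \<in> ext_ideal m"
    by (simp add: tensor_mult_add_left tensor_mult_add_right tensor_mult_single_single)
  from ext_ideal_diff[OF ext_ideal_diff[OF this single_square_in_ext_ideal[of i m r]]
      single_square_in_ext_ideal[of j m r]] assms
  show ?thesis by (simp add: algebra_simps)
qed

text \<open>The offset \<open>j\<close> is the letter belonging to the first bit; it grows as
  \<open>clifford\<close> shifts its vectors.\<close>

fun bits_word :: "nat \<Rightarrow> bool list \<Rightarrow> nat list" where
  "bits_word j [] = []"
| "bits_word j (True # s) = j # bits_word (Suc j) s"
| "bits_word j (False # s) = bits_word (Suc j) s"

lemma set_bits_word: "set (bits_word j s) \<subseteq> {j..<j + length s}"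
  by (induction j s rule: bits_word.induct) auto

lemma length_bits_word: "length (bits_word j s) = count_list s True"
  by (induction j s rule: bits_word.induct) auto

lemma bits_word_no_True: "True \<notin> set s \<Longrightarrow> bits_word j s = []"
  by (induction j s rule: bits_word.induct) auto

text \<open>One pass of insertion sort: \<open>i\<close> moves past each smaller letter at the cost
  of a sign and vanishes when it meets itself, so the constructed \<open>c\<close> is 1, -1 or
  0.\<close>

lemma single_Cons_bits_word:
  assumes "i \<in> {j..<j + length s}" "j + length s \<le> m"
  shows "\<exists>c t. length t = length s \<and>
    (\<lambda>w. single (i # bits_word j s) w - c * single (bits_word j t) w :: 'a::comm_ring_1) \<in> ext_ideal m"
  using assms
proof (induction j s rule: bits_word.induct)
  case (2 j s)
  have r: "set (bits_word (Suc j) s) \<subseteq> {..<m}" "i < m" "j < m"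
    using set_bits_word[of "Suc j" s] "2.prems" by fastforce+
  show ?case
  proof (cases "i = j")
    case True
    then show ?thesis
      using single_square_in_ext_ideal[of j m "bits_word (Suc j) s"] r
      by (intro exI[of _ 0] exI[of _ "True # s"]) simp
  next
    case False
    then obtain c t where t: "length t = length s"
      and ct: "(\<lambda>w. single (i # bits_word (Suc j) s) w - c * single (bits_word (Suc j) t) w :: 'a) \<in> ext_ideal m"
      using "2.IH" "2.prems" by auto
    have "(\<lambda>w. single (j # i # bits_word (Suc j) s) w - c * single (j # bits_word (Suc j) t) w :: 'a)
        \<in> ext_ideal m"
      using ext_ideal_mult_left[OF ct tensors_single[of "[j]"]] r
      by (simp add: tensor_mult_diff_right tensor_mult_scale_right tensor_mult_single_single)
    from ext_ideal_diff[OF single_swap_in_ext_ideal[of i m j "bits_word (Suc j) s"] this] r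
    have "(\<lambda>w. single (i # bits_word j (True # s)) w - (- c) * single (bits_word j (True # t)) w :: 'a)
        \<in> ext_ideal m"
      by (simp add: algebra_simps)
    with t show ?thesis by (intro exI[of _ "- c"] exI[of _ "True # t"]) simp
  qed
next
  case (3 j s)
  show ?case
  proof (cases "i = j")
    case True
    then show ?thesis
      by (intro exI[of _ 1] exI[of _ "True # s"]) (simp add: ext_ideal_zero)
  next
    case False
    then obtain c t where "length t = length s"
      and "(\<lambda>w. single (i # bits_word (Suc j) s) w - c * single (bits_word (Suc j) t) w :: 'a) \<in> ext_ideal m"
      using "3.IH" "3.prems" by auto
    then show ?thesis by (intro exI[of _ c] exI[of _ "False # t"]) simp
  qed
qed simp

lemma single_mod_ext_ideal:
  assumes "set w \<subseteq> {..<m}"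
  shows "\<exists>c t. length t = m \<and>
    (\<lambda>u. single w u - c * single (bits_word 0 t) u :: 'a::comm_ring_1) \<in> ext_ideal m"
  using assms
proof (induction w)
  case Nil
  have "bits_word 0 (replicate m False) = []"
    by (rule bits_word_no_True) auto
  then show ?case
    by (intro exI[of _ 1] exI[of _ "replicate m False"]) (simp add: ext_ideal_zero)
next
  case (Cons i w)
  then obtain c t where t: "length t = m"
    and ct: "(\<lambda>u. single w u - c * single (bits_word 0 t) u :: 'a) \<in> ext_ideal m"
    by auto
  obtain c' t' where t': "length t' = m"
    and ct': "(\<lambda>u. single (i # bits_word 0 t) u - c' * single (bits_word 0 t') u :: 'a) \<in> ext_ideal m"
    using single_Cons_bits_word[of i 0 t m] Cons.prems t by auto
  have "(\<lambda>u. single (i # w) u - c * single (i # bits_word 0 t) u :: 'a) \<in> ext_ideal m"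
    using ext_ideal_mult_left[OF ct tensors_single[of "[i]"]] Cons.prems
    by (simp add: tensor_mult_diff_right tensor_mult_scale_right tensor_mult_single_single)
  from ext_ideal_add[OF this ext_ideal_scale[OF ct', of c]]
  have "(\<lambda>u. single (i # w) u - (c * c') * single (bits_word 0 t') u :: 'a) \<in> ext_ideal m"
    by (simp add: algebra_simps)
  with t' show ?case by blast
qed

abbreviation bit_strings :: "nat \<Rightarrow> bool list set" where
  "bit_strings m \<equiv> {s. length s = m}"

lemma finite_bit_strings: "finite (bit_strings m)"
  using finite_lists_length_eq[of "UNIV :: bool set" m] by simp

definition bits_tensor :: "nat \<Rightarrow> (bool list \<Rightarrow> 'a::comm_ring_1) \<Rightarrow> nat list \<Rightarrow> 'a" where
  "bits_tensor m c = (\<lambda>w. \<Sum>s\<in>bit_strings m. c s * single (bits_word 0 s) w)"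

lemma single_bits_word_tensors: "length s = m \<Longrightarrow> single (bits_word 0 s) \<in> tensors m"
  using set_bits_word[of 0 s] by (intro tensors_single) auto

lemma bits_tensor_tensors: "bits_tensor m c \<in> tensors m"
  unfolding bits_tensor_def
  by (intro tensors_sum tensors_scale single_bits_word_tensors) simp

lemma tensor_mod_ext_ideal:
  assumes "x \<in> tensors m"
  shows "\<exists>c. (\<lambda>u. x u - bits_tensor m c u) \<in> ext_ideal m"
proof -
  let ?X = "{w. x w \<noteq> 0}"
  have fin: "finite ?X" and sub: "\<And>w. w \<in> ?X \<Longrightarrow> set w \<subseteq> {..<m}"
    using assms by (auto simp: tensors_def)
  have "\<forall>w\<in>?X. \<exists>c t. length t = m \<and>
      (\<lambda>u. single w u - c * single (bits_word 0 t) u :: 'a) \<in> ext_ideal m"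
    using single_mod_ext_ideal sub by blast
  then obtain c t where "\<forall>w\<in>?X. length (t w) = m \<and>
      (\<lambda>u. single w u - c w * single (bits_word 0 (t w)) u :: 'a) \<in> ext_ideal m"
    unfolding bchoice_iff by blast
  then have t: "length (t w) = m"
    and ct: "(\<lambda>u. single w u - c w * single (bits_word 0 (t w)) u :: 'a) \<in> ext_ideal m"
    if "w \<in> ?X" for w
    using that by blast+
  \<comment> \<open>\<open>d s\<close> collects the contributions of all words whose normal form is
    a multiple of the monomial of \<open>s\<close>.\<close>
  define d where "d s = (\<Sum>w | w \<in> ?X \<and> t w = s. x w * c w)" for s
  have "(\<lambda>u. \<Sum>w\<in>?X. x w * (single w u - c w * single (bits_word 0 (t w)) u)) \<in> ext_ideal m"
    by (intro ext_ideal_sum ext_ideal_scale ct)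
  moreover have "(\<Sum>w\<in>?X. x w * (single w u - c w * single (bits_word 0 (t w)) u))
      = x u - bits_tensor m d u" for u
  proof -
    have "(\<Sum>w\<in>?X. x w * single w u) = x u"
      using fin by (simp add: single_def if_distrib[of "\<lambda>t. _ * t"] cong: if_cong)
    moreover have "(\<Sum>w\<in>?X. x w * (c w * single (bits_word 0 (t w)) u)) = bits_tensor m d u"
    proof -
      have "(\<Sum>w\<in>?X. x w * (c w * single (bits_word 0 (t w)) u))
          = (\<Sum>s\<in>bit_strings m. \<Sum>w | w \<in> ?X \<and> t w = s. x w * (c w * single (bits_word 0 (t w)) u))"
        by (rule sum.group[symmetric]) (use fin finite_bit_strings t in auto)
      then show ?thesis
        by (simp add: bits_tensor_def d_def sum_distrib_right mult.assoc)
    qed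
    ultimately show ?thesis
      by (simp add: right_diff_distrib sum_subtractf)
  qed
  ultimately show ?thesis by auto
qed

section \<open>Coordinates and bases of the exterior algebra\<close>

text \<open>The unit of the exterior algebra, in all dimensions at once; words act on it to produce
  coordinates.\<close>

definition one_bits :: "bool list \<Rightarrow> 'a::comm_ring_1" where
  "one_bits s = (if True \<in> set s then 0 else 1)"

lemma one_bits_Cons [simp]: "one_bits (False # s) = one_bits s" "one_bits (True # s) = 0"
  by (simp_all add: one_bits_def)

text \<open>What remains of the \<open>i\<close>-th unit vector after the recursion of
  \<open>clifford\<close> has dropped \<open>j\<close> coordinates; \<open>unit_from 0\<close> is
  the standard basis.\<close>

definition unit_from :: "nat \<Rightarrow> nat \<Rightarrow> nat \<Rightarrow> 'a::comm_ring_1" where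
  "unit_from j i k = (if j + k = i then 1 else 0)"

lemma unit_from_above:
  assumes "Suc j \<le> i"
  shows "unit_from j i 0 = 0" "(\<lambda>k. unit_from j i (Suc k)) = unit_from (Suc j) i"
  using assms by (auto simp: unit_from_def)

text \<open>Letters above \<open>j\<close> have leading coordinate zero and leave the leading bit
  alone.\<close>

lemma wedges_shift:
  assumes "set w \<subseteq> {Suc j..}"
  shows "wedges (unit_from j) w g (False # s) = wedges (unit_from (Suc j)) w (\<lambda>t. g (False # t)) s"
  using assms by (induction w arbitrary: s) (simp_all add: unit_from_above)

lemma wedges_shift_zero:
  assumes "set w \<subseteq> {Suc j..}" "\<And>t. g (True # t) = 0"
  shows "wedges (unit_from j) w g (True # s) = 0"
  using assms by (induction w arbitrary: s) (simp_all add: unit_from_above)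

text \<open>No sign appears: in an increasing word each letter acts after all larger ones and sets a
  bit in front of theirs. Evaluation at bit strings therefore separates the increasing
  monomials.\<close>

lemma wedges_bits_word:
  "length t = length s \<Longrightarrow> wedges (unit_from j) (bits_word j s) one_bits t = (if t = s then 1 else 0)"
proof (induction j s arbitrary: t rule: bits_word.induct)
  case (1 j)
  then show ?case by (simp add: one_bits_def)
next
  case (2 j s)
  then obtain b t' where t: "t = b # t'" "length t' = length s" by (cases t) auto
  have w: "set (bits_word (Suc j) s) \<subseteq> {Suc j..}"
    using set_bits_word[of "Suc j" s] by auto
  have i: "unit_from j j 0 = 1" "(\<lambda>k. unit_from j j (Suc k)) = (\<lambda>_. 0)"
    by (auto simp: unit_from_def)
  from 2 t show ?case by (cases b) (simp_all add: i wedges_shift[OF w])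
next
  case (3 j s)
  then obtain b t' where t: "t = b # t'" "length t' = length s" by (cases t) auto
  have w: "set (bits_word (Suc j) s) \<subseteq> {Suc j..}"
    using set_bits_word[of "Suc j" s] by auto
  from 3 t show ?case
    by (cases b) (simp_all add: wedges_shift[OF w] wedges_shift_zero[OF w])
qed

text \<open>On strings of length \<open>m\<close> these are the coordinates with respect to the
  increasing monomials.\<close>

definition ext_coord :: "(nat list \<Rightarrow> 'a::comm_ring_1) \<Rightarrow> bool list \<Rightarrow> 'a" where
  "ext_coord x = rep (unit_from 0) x one_bits"

lemma ext_coord_bits_word:
  "length t = length s \<Longrightarrow> ext_coord (single (bits_word 0 s)) t = (if t = s then 1 else 0)"
  by (simp add: ext_coord_def wedges_bits_word)

lemma rep_bits_tensor:
  "rep a (bits_tensor m c) g t = (\<Sum>s\<in>bit_strings m. c s * wedges a (bits_word 0 s) g t)"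
proof -
  have "rep a (bits_tensor m c) g t
      = (\<Sum>s\<in>bit_strings m. rep a (\<lambda>w. c s * single (bits_word 0 s) w) g t)"
    unfolding bits_tensor_def
    by (rule rep_sum[of _ _ m]) (simp add: tensors_scale single_bits_word_tensors)
  then show ?thesis
    by (simp add: rep_scale[OF single_bits_word_tensors])
qed

lemma ext_coord_bits_tensor:
  assumes "length t = m" shows "ext_coord (bits_tensor m c) t = c t"
proof -
  have "ext_coord (bits_tensor m c) t = (\<Sum>s\<in>bit_strings m. c s * (if t = s then 1 else 0))"
    unfolding ext_coord_def rep_bits_tensor
    by (rule sum.cong) (use assms in \<open>simp_all add: wedges_bits_word\<close>)
  with assms show ?thesis
    by (simp add: finite_bit_strings if_distrib[of "\<lambda>t. _ * t"] cong: if_cong)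
qed

text \<open>Spanning and independence meet here: sorting yields some coefficients \<open>c\<close>,
  and the representation, which kills the ideal, identifies them.\<close>

lemma tensor_eq_bits_tensor:
  assumes "x \<in> tensors m"
  shows "(\<lambda>u. x u - bits_tensor m (ext_coord x) u) \<in> ext_ideal m"
proof -
  obtain c where c: "(\<lambda>u. x u - bits_tensor m c u) \<in> ext_ideal m"
    using tensor_mod_ext_ideal[OF assms] by blast
  have "c t = ext_coord x t" if "t \<in> bit_strings m" for t
  proof -
    have "ext_coord x t - ext_coord (bits_tensor m c) t = 0"
      using rep_ext_ideal[OF c, of "unit_from 0" one_bits t]
      by (simp add: ext_coord_def rep_diff[OF assms bits_tensor_tensors])
    with that show ?thesis by (simp add: ext_coord_bits_tensor)
  qed
  then have "bits_tensor m c = bits_tensor m (ext_coord x)"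
    by (simp add: bits_tensor_def)
  with c show ?thesis by simp
qed

text \<open>Every wedge representation factors through the coordinates; this is what lets a matrix
  act on coordinate functions in \<open>ext_lin\<close>.\<close>

lemma rep_conv_ext_coord:
  assumes "x \<in> tensors m"
  shows "rep a x g t = (\<Sum>s\<in>bit_strings m. ext_coord x s * wedges a (bits_word 0 s) g t)"
proof -
  have "rep a x g t = rep a (bits_tensor m (ext_coord x)) g t"
    using rep_ext_ideal[OF tensor_eq_bits_tensor[OF assms], of a g t]
    by (simp add: rep_diff[OF assms bits_tensor_tensors])
  then show ?thesis by (simp add: rep_bits_tensor)
qed

lemma ext_ideal_iff:
  assumes "x \<in> tensors m"
  shows "x \<in> ext_ideal m \<longleftrightarrow> (\<forall>s\<in>bit_strings m. ext_coord x s = 0)"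
proof
  assume "\<forall>s\<in>bit_strings m. ext_coord x s = 0"
  then have "bits_tensor m (ext_coord x) = (\<lambda>_. 0)"
    by (simp add: bits_tensor_def)
  with tensor_eq_bits_tensor[OF assms] show "x \<in> ext_ideal m" by simp
qed (simp add: ext_coord_def rep_ext_ideal)

lemma ext_class_eq_iff:
  assumes "x \<in> tensors m" "y \<in> tensors m"
  shows "ext_class m x = ext_class m y \<longleftrightarrow> (\<forall>s\<in>bit_strings m. ext_coord x s = ext_coord y s)"
proof -
  interpret T: ring "tensor_algebra m :: ('a, _) module" by (rule ring_tensor_algebra)
  have "\<ominus>\<^bsub>tensor_algebra m\<^esub> y = (\<lambda>w. - y w)"
    by (rule T.minus_equality) (use assms in \<open>auto intro: tensors_minus\<close>)
  then have "x \<ominus>\<^bsub>tensor_algebra m\<^esub> y = (\<lambda>w. x w - y w)"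
    by (simp add: a_minus_def)
  then have "ext_class m x = ext_class m y \<longleftrightarrow> (\<lambda>w. x w - y w) \<in> ext_ideal m"
    using T.quotient_eq_iff_same_a_r_cos[OF ideal_ext_ideal, of x y] assms
    by (simp add: ext_class_def)
  also have "\<dots> \<longleftrightarrow> (\<forall>s\<in>bit_strings m. ext_coord x s = ext_coord y s)"
    using assms by (simp add: ext_ideal_iff tensors_diff ext_coord_def rep_diff[of _ m])
  finally show ?thesis .
qed

lemma mem_ext_class_iff: "y \<in> ext_class m x \<longleftrightarrow> (\<exists>z\<in>ext_ideal m. y = (\<lambda>w. z w + x w))"
  by (auto simp: ext_class_def a_r_coset_def')

lemma self_mem_ext_class: "x \<in> ext_class m x"
  unfolding mem_ext_class_iff by (rule bexI[OF _ ext_ideal_zero]) simp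

text \<open>Makes the unions over representatives, in the scalar multiplication and in
  \<open>ext_map\<close>, collapse to a single class.\<close>

lemma mem_ext_classD:
  assumes "y \<in> ext_class m x" "x \<in> tensors m"
  shows "y \<in> tensors m" "rep a y g s = rep a x g s"
proof -
  obtain z where z: "z \<in> ext_ideal m" "y = (\<lambda>w. z w + x w)"
    using assms by (auto simp: mem_ext_class_iff)
  then show "y \<in> tensors m"
    using assms by (simp add: tensors_add ext_ideal_tensors)
  show "rep a y g s = rep a x g s"
    using z assms by (simp add: rep_add[of _ m] ext_ideal_tensors rep_ext_ideal)
qed

section \<open>Module operations on classes of tensors\<close>

lemma ext_algebra_simps:
  "carrier (ext_algebra m) = carrier (tensor_algebra m Quot ext_ideal m)"
  "add (ext_algebra m) = add (tensor_algebra m Quot ext_ideal m)"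
  "zero (ext_algebra m) = zero (tensor_algebra m Quot ext_ideal m)"
  "smult (ext_algebra m) = (\<lambda>c X. \<Union>x\<in>X. ext_class m (c \<odot>\<^bsub>tensor_algebra m\<^esub> x))"
  by (simp_all add: ext_algebra_def ring.defs module.defs)

lemma ext_class_carrier: "x \<in> tensors m \<Longrightarrow> ext_class m x \<in> carrier (ext_algebra m)"
  by (auto simp: ext_algebra_simps FactRing_def A_RCOSETS_def' ext_class_def)

lemma ext_class_add:
  assumes "x \<in> tensors m" "y \<in> tensors m"
  shows "ext_class m x \<oplus>\<^bsub>ext_algebra m\<^esub> ext_class m y = ext_class m (\<lambda>w. x w + y w)"
proof -
  interpret I: ideal "ext_ideal m" "tensor_algebra m :: ('a, _) module" by (rule ideal_ext_ideal)
  show ?thesis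
    using I.a_rcos_sum[of x y] assms by (simp add: ext_algebra_simps FactRing_def ext_class_def)
qed

lemma ext_class_zero: "\<zero>\<^bsub>ext_algebra m\<^esub> = ext_class m (\<lambda>_. 0)"
  by (auto simp: ext_algebra_simps FactRing_def mem_ext_class_iff)

lemma ext_class_smult:
  assumes "x \<in> tensors m"
  shows "c \<odot>\<^bsub>ext_algebra m\<^esub> ext_class m x = ext_class m (\<lambda>w. c * x w)"
proof -
  have "ext_class m (\<lambda>w. c * y w) = ext_class m (\<lambda>w. c * x w)" if "y \<in> ext_class m x" for y
    using mem_ext_classD[OF that assms] assms
    by (simp add: ext_class_eq_iff tensors_scale ext_coord_def rep_scale[of _ m])
  then have "c \<odot>\<^bsub>ext_algebra m\<^esub> ext_class m x
      = (\<Union>y\<in>ext_class m x. ext_class m (\<lambda>w. c * x w))"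
    unfolding ext_algebra_simps tensor_algebra_simps by (intro SUP_cong refl)
  also have "\<dots> = ext_class m (\<lambda>w. c * x w)"
    using self_mem_ext_class[of x m] by blast
  finally show ?thesis .
qed

lemma abelian_group_ext_algebra: "abelian_group (ext_algebra m)"
proof -
  interpret Q: ring "tensor_algebra m Quot ext_ideal m"
    by (rule ideal.quotient_is_ring[OF ideal_ext_ideal])
  have neg: "\<exists>y\<in>carrier (tensor_algebra m Quot ext_ideal m).
      y \<oplus>\<^bsub>tensor_algebra m Quot ext_ideal m\<^esub> x = \<zero>\<^bsub>tensor_algebra m Quot ext_ideal m\<^esub>"
    if "x \<in> carrier (tensor_algebra m Quot ext_ideal m)" for x
    using that Q.l_neg Q.a_inv_closed by blast
  show ?thesis
    by (rule abelian_groupI, unfold ext_algebra_simps)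
      (rule Q.a_closed Q.zero_closed Q.a_assoc Q.a_comm Q.l_zero neg;
        assumption)+
qed

lemma finsum_ext_class:
  fixes x :: "'k \<Rightarrow> nat list \<Rightarrow> 'a::comm_ring_1"
  assumes "finite A" "\<And>k. k \<in> A \<Longrightarrow> x k \<in> tensors m"
  shows "(\<Oplus>\<^bsub>ext_algebra m\<^esub>k\<in>A. ext_class m (x k)) = ext_class m (\<lambda>w. \<Sum>k\<in>A. x k w)"
proof -
  interpret Q: abelian_group "ext_algebra m :: ('a, _) module" by (rule abelian_group_ext_algebra)
  show ?thesis
    using assms
    by (induction A rule: finite_induct)
      (simp_all add: ext_class_zero Q.finsum_insert Pi_def ext_class_carrier ext_class_add tensors_sum)
qed

lemma list_lincomb_ext_class:
  fixes xs :: "(nat list \<Rightarrow> 'a::comm_ring_1) list"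
  assumes "set xs \<subseteq> tensors m"
  shows "list_lincomb (ext_algebra m) (map (ext_class m) xs) c
    = ext_class m (\<lambda>w. \<Sum>i<length xs. c $ i * (xs ! i) w)"
proof -
  interpret Q: abelian_group "ext_algebra m :: ('a, _) module" by (rule abelian_group_ext_algebra)
  have xs: "xs ! i \<in> tensors m" if "i < length xs" for i
    using assms that by auto
  have "list_lincomb (ext_algebra m) (map (ext_class m) xs) c
      = (\<Oplus>\<^bsub>ext_algebra m\<^esub>i\<in>{..<length xs}. ext_class m (\<lambda>w. c $ i * (xs ! i) w))"
    unfolding list_lincomb_def
    by (rule Q.finsum_cong') (auto simp: ext_class_smult xs intro!: ext_class_carrier tensors_scale)
  also have "\<dots> = ext_class m (\<lambda>w. \<Sum>i<length xs. c $ i * (xs ! i) w)"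
    by (rule finsum_ext_class) (auto intro: tensors_scale xs)
  finally show ?thesis .
qed

section \<open>Monomial bases\<close>

definition bits_basis :: "nat \<Rightarrow> bool list list \<Rightarrow> (nat list \<Rightarrow> 'a::comm_ring_1) set list" where
  "bits_basis m bs = map (\<lambda>s. ext_class m (single (bits_word 0 s))) bs"

lemma length_bits_basis [simp]: "length (bits_basis m bs) = length bs"
  by (simp add: bits_basis_def)

text \<open>One equivalence yields existence of coefficients, their uniqueness, and the value of
  \<open>coords\<close>. The second assumption on \<open>x\<close> places its class in the span of
  the listed monomials.\<close>

lemma list_lincomb_bits_basis_iff:
  fixes c :: "'a::comm_ring_1 vec"
  assumes bs: "distinct bs" "set bs \<subseteq> bit_strings m"
    and x: "x \<in> tensors m" "\<And>s. s \<in> bit_strings m \<Longrightarrow> s \<notin> set bs \<Longrightarrow> ext_coord x s = 0"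
    and c: "c \<in> carrier_vec (length bs)"
  shows "list_lincomb (ext_algebra m) (bits_basis m bs) c = ext_class m x
    \<longleftrightarrow> c = vec_on bs (ext_coord x)"
proof -
  define e where "e i = (single (bits_word 0 (bs ! i)) :: nat list \<Rightarrow> 'a)" for i
  define y where "y = (\<lambda>w. \<Sum>i<length bs. c $ i * e i w)"
  have len: "length (bs ! i) = m" if "i < length bs" for i
    using subsetD[OF bs(2) nth_mem[OF that]] by simp
  have e: "e i \<in> tensors m" if "i < length bs" for i
    unfolding e_def by (rule single_bits_word_tensors[OF len[OF that]])
  have y: "y \<in> tensors m"
    unfolding y_def by (intro tensors_sum tensors_scale e) simp
  have coord: "ext_coord y t = (\<Sum>i<length bs. c $ i * (if t = bs ! i then 1 else 0))"
    if t: "length t = m" for t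
  proof -
    have "ext_coord y t = (\<Sum>i<length bs. ext_coord (\<lambda>w. c $ i * e i w) t)"
      unfolding ext_coord_def y_def by (rule rep_sum[of _ _ m]) (simp add: tensors_scale e)
    also have "\<dots> = (\<Sum>i<length bs. c $ i * ext_coord (e i) t)"
      by (rule sum.cong) (simp_all add: ext_coord_def rep_scale[OF e])
    also have "\<dots> = (\<Sum>i<length bs. c $ i * (if t = bs ! i then 1 else 0))"
    proof (rule sum.cong)
      fix i assume "i \<in> {..<length bs}"
      then have "length (bs ! i) = m" using len by simp
      with t show "c $ i * ext_coord (e i) t = c $ i * (if t = bs ! i then 1 else 0)"
        unfolding e_def by (subst ext_coord_bits_word) auto
    qed simp
    finally show ?thesis .
  qed
  have coord_nth: "ext_coord y (bs ! j) = c $ j" if j: "j < length bs" for j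
  proof -
    have "ext_coord y (bs ! j) = (\<Sum>i<length bs. if i = j then c $ i else 0)"
      unfolding coord[OF len[OF j]]
      by (intro sum.cong refl) (use bs(1) j in \<open>auto simp: nth_eq_iff_index_eq\<close>)
    with j show ?thesis by simp
  qed
  have coord_notin: "ext_coord y t = 0" if "length t = m" "t \<notin> set bs" for t
    unfolding coord[OF that(1)] by (rule sum.neutral) (use that(2) in auto)
  have lin: "list_lincomb (ext_algebra m) (bits_basis m bs) c = ext_class m y"
  proof -
    let ?xs = "map (\<lambda>s. single (bits_word 0 s) :: nat list \<Rightarrow> 'a) bs"
    have "set ?xs \<subseteq> tensors m"
      using bs(2) by (auto intro!: single_bits_word_tensors)
    from list_lincomb_ext_class[OF this, of c]
    have "list_lincomb (ext_algebra m) (bits_basis m bs) c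
        = ext_class m (\<lambda>w. \<Sum>i<length bs. c $ i * (?xs ! i) w)"
      by (simp only: bits_basis_def map_map comp_def length_map)
    also have "(\<lambda>w. \<Sum>i<length bs. c $ i * (?xs ! i) w) = y"
      unfolding y_def e_def by (intro ext sum.cong) simp_all
    finally show ?thesis .
  qed
  have "(\<forall>s\<in>bit_strings m. ext_coord y s = ext_coord x s) \<longleftrightarrow> (\<forall>j<length bs. c $ j = ext_coord x (bs ! j))"
  proof (intro iffI ballI allI impI)
    fix j assume "\<forall>s\<in>bit_strings m. ext_coord y s = ext_coord x s" "j < length bs"
    then show "c $ j = ext_coord x (bs ! j)"
      using coord_nth[of j] len[of j] by simp
  next
    fix s assume *: "\<forall>j<length bs. c $ j = ext_coord x (bs ! j)" "s \<in> bit_strings m"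
    show "ext_coord y s = ext_coord x s"
    proof (cases "s \<in> set bs")
      case True
      then obtain j where "j < length bs" "s = bs ! j" by (auto simp: in_set_conv_nth)
      with * coord_nth show ?thesis by simp
    next
      case False
      with * coord_notin x(2) show ?thesis by simp
    qed
  qed
  also have "\<dots> \<longleftrightarrow> c = vec_on bs (ext_coord x)"
    using c by (auto intro!: eq_vecI)
  finally show ?thesis
    by (simp add: lin ext_class_eq_iff[OF y x(1)])
qed

lemma coords_bits_basis:
  assumes "distinct bs" "set bs \<subseteq> bit_strings m"
    and "x \<in> tensors m" "\<And>s. s \<in> bit_strings m \<Longrightarrow> s \<notin> set bs \<Longrightarrow> ext_coord x s = 0"
  shows "coords (ext_algebra m) (bits_basis m bs) (ext_class m x) = vec_on bs (ext_coord x)"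
  unfolding coords_def
  by (rule the_equality) (use list_lincomb_bits_basis_iff[OF assms] in auto)

text \<open>Each letter flips the parity of the number of \<open>True\<close> bits, starting from
  \<open>one_bits\<close>, which lives on strings without \<open>True\<close>.\<close>

lemma wedges_parity:
  "odd (length w) \<noteq> odd (count_list s True) \<Longrightarrow> wedges a w one_bits s = 0"
proof (induction w arbitrary: s)
  case Nil
  then have "True \<in> set s"
    by (metis count_notin even_zero list.size(3))
  then show ?case by (simp add: one_bits_def)
next
  case (Cons i w)
  show ?case
    unfolding foldr.simps o_apply
    by (rule clifford_parity) (rule Cons.IH, use Cons.prems in auto)
qed

lemma ext_coord_parity:
  assumes "\<And>w. x w \<noteq> 0 \<Longrightarrow> odd (length w) \<noteq> odd (count_list s True)"
  shows "ext_coord x s = 0"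
  unfolding ext_coord_def rep_def lin_ext_def
  by (rule sum.neutral) (use assms in \<open>simp add: wedges_parity\<close>)

text \<open>The flag \<open>b\<close> treats both parities at once. A tensor of one parity has zero
  coordinates on strings of the other, as \<open>list_lincomb_bits_basis_iff\<close>
  requires.\<close>

lemma ordered_basis_bits_basis:
  assumes bs: "distinct bs" "set bs = {s. length s = m \<and> odd (count_list s True) = b}"
  shows "ordered_basis (ext_algebra m) (ext_part {k. odd k = b} m)
    (bits_basis m bs :: (nat list \<Rightarrow> 'a::comm_ring_1) set list)"
  unfolding ordered_basis_def
proof (intro conjI ballI)
  have "ext_class m (single (bits_word 0 s) :: nat list \<Rightarrow> 'a) \<in> ext_part {k. odd k = b} m" if "s \<in> set bs" for s
  proof -
    have "odd (length w) = b" if "single (bits_word 0 s) w \<noteq> (0::'a)" for w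
      using that \<open>s \<in> set bs\<close> bs(2)
      by (auto simp: single_def length_bits_word split: if_splits)
    moreover have "(single (bits_word 0 s) :: nat list \<Rightarrow> 'a) \<in> tensors m"
      using that bs(2) by (intro single_bits_word_tensors) simp
    ultimately show ?thesis
      unfolding ext_part_def by (intro CollectI exI[of _ "single (bits_word 0 s)"]) auto
  qed
  then show "set (bits_basis m bs :: (nat list \<Rightarrow> 'a) set list) \<subseteq> ext_part {k. odd k = b} m"
    by (auto simp: bits_basis_def)
next
  fix X :: "(nat list \<Rightarrow> 'a) set" assume "X \<in> ext_part {k. odd k = b} m"
  then obtain x where x: "x \<in> tensors m" "\<And>w. x w \<noteq> 0 \<Longrightarrow> odd (length w) = b" "X = ext_class m x"
    by (auto simp: ext_part_def)
  have "ext_coord x s = 0" if "s \<in> bit_strings m" "s \<notin> set bs" for s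
    by (rule ext_coord_parity) (use that x(2) bs(2) in auto)
  then have "list_lincomb (ext_algebra m) (bits_basis m bs) c = X \<longleftrightarrow> c = vec_on bs (ext_coord x)"
    if "c \<in> carrier_vec (length bs)" for c
    using list_lincomb_bits_basis_iff[OF bs(1) _ x(1) _ that] bs(2) x(3) by auto
  then show "\<exists>!c. c \<in> carrier_vec (length (bits_basis m bs))
      \<and> list_lincomb (ext_algebra m) (bits_basis m bs) c = X"
    by (intro ex1I[of _ "vec_on bs (ext_coord x)"]) auto
qed

section \<open>Functoriality and equivariance\<close>

text \<open>Indices are swapped relative to \<open>$$\<close>, so that
  \<open>mat_cols \<phi> j\<close> is the vector to be substituted for the letter
  \<open>j\<close>.\<close>

definition mat_cols :: "'a mat \<Rightarrow> nat \<Rightarrow> nat \<Rightarrow> 'a" where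
  "mat_cols \<phi> = (\<lambda>j k. \<phi> $$ (k, j))"

definition vec_prod :: "'a::comm_ring_1 mat \<Rightarrow> nat list \<Rightarrow> nat list \<Rightarrow> 'a" where
  "vec_prod \<phi> w = foldr tensor_mult (map (\<lambda>j. tensor_of_vec (col \<phi> j)) w) tensor_one"

lemma vec_prod_simps [simp]:
  "vec_prod \<phi> [] = tensor_one"
  "vec_prod \<phi> (j # w) = tensor_mult (tensor_of_vec (col \<phi> j)) (vec_prod \<phi> w)"
  by (simp_all add: vec_prod_def)

lemma col_carrier: "\<phi> \<in> carrier_mat m m \<Longrightarrow> col \<phi> j \<in> carrier_vec m"
  by (rule carrier_vecI) auto

lemma vec_prod_tensors: "\<phi> \<in> carrier_mat m m \<Longrightarrow> vec_prod \<phi> w \<in> tensors m"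
  by (induction w) (simp_all add: tensors_one tensors_mult tensors_of_vec col_carrier)

lemma ext_coord_tensor_of_vec_mult:
  assumes "v \<in> carrier_vec m" "x \<in> tensors m" "length s = m"
  shows "ext_coord (tensor_mult (tensor_of_vec v) x) s = wedge (($) v) (ext_coord x) s"
proof -
  have "ext_coord (tensor_mult (tensor_of_vec v) x) s
      = wedge (\<lambda>k. \<Sum>i<m. v $ i * unit_from 0 i k) (ext_coord x) s"
    using assms by (simp add: ext_coord_def rep_tensor_mult[of _ m] tensors_of_vec rep_tensor_of_vec)
  also have "\<dots> = wedge (($) v) (ext_coord x) s"
    by (rule clifford_cong) (use assms(3) in \<open>auto simp: unit_from_def if_distrib[of "\<lambda>t. _ * t"] cong: if_cong\<close>)
  finally show ?thesis .
qed

lemma ext_coord_vec_prod: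
  assumes "\<phi> \<in> carrier_mat m m" "length s = m"
  shows "ext_coord (vec_prod \<phi> w) s = wedges (mat_cols \<phi>) w one_bits s"
  using assms(2)
proof (induction w arbitrary: s)
  case Nil
  then show ?case by (simp add: ext_coord_def)
next
  case (Cons j w)
  have "ext_coord (vec_prod \<phi> (j # w)) s = wedge (($) (col \<phi> j)) (ext_coord (vec_prod \<phi> w)) s"
    using assms(1) Cons.prems
    by (simp add: ext_coord_tensor_of_vec_mult[of _ m] col_carrier vec_prod_tensors)
  also have "\<dots> = wedges (mat_cols \<phi>) (j # w) one_bits s"
    unfolding foldr.simps o_apply
    by (rule clifford_cong) (use assms(1) Cons in \<open>auto simp: mat_cols_def col_def\<close>)
  finally show ?case .
qed

lemma tensor_map_conv: "tensor_map \<phi> x = (\<lambda>u. \<Sum>w | x w \<noteq> 0. x w * vec_prod \<phi> w u)"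
  by (simp add: tensor_map_def vec_prod_def)

lemma tensor_map_tensors: "\<phi> \<in> carrier_mat m m \<Longrightarrow> tensor_map \<phi> x \<in> tensors m"
  unfolding tensor_map_conv by (intro tensors_sum tensors_scale vec_prod_tensors)

lemma ext_coord_tensor_map:
  assumes "\<phi> \<in> carrier_mat m m" "length s = m"
  shows "ext_coord (tensor_map \<phi> x) s = rep (mat_cols \<phi>) x one_bits s"
proof -
  have "ext_coord (tensor_map \<phi> x) s = (\<Sum>w | x w \<noteq> 0. ext_coord (\<lambda>u. x w * vec_prod \<phi> w u) s)"
    unfolding ext_coord_def tensor_map_conv
    by (rule rep_sum[of _ _ m]) (simp add: assms tensors_scale vec_prod_tensors)
  also have "\<dots> = (\<Sum>w | x w \<noteq> 0. x w * ext_coord (vec_prod \<phi> w) s)"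
    by (simp add: ext_coord_def rep_scale[OF vec_prod_tensors[OF assms(1)]])
  finally show ?thesis
    by (simp add: ext_coord_vec_prod[OF assms] rep_def lin_ext_def)
qed

lemma ext_map_ext_class:
  assumes "\<phi> \<in> carrier_mat m m" "x \<in> tensors m"
  shows "ext_map m \<phi> (ext_class m x) = ext_class m (tensor_map \<phi> x)"
proof -
  have "ext_class m (tensor_map \<phi> y) = ext_class m (tensor_map \<phi> x)" if "y \<in> ext_class m x" for y
    using mem_ext_classD[OF that assms(2)] assms
    by (simp add: ext_class_eq_iff tensor_map_tensors ext_coord_tensor_map)
  then have "ext_map m \<phi> (ext_class m x) = (\<Union>y\<in>ext_class m x. ext_class m (tensor_map \<phi> x))"
    unfolding ext_map_def by (intro SUP_cong refl)
  also have "\<dots> = ext_class m (tensor_map \<phi> x)"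
    using self_mem_ext_class[of x m] by blast
  finally show ?thesis .
qed

text \<open>For \<open>a = mat_cols \<phi>\<close> and strings of length \<open>m\<close>, the
  entries are the minors of \<open>\<phi>\<close> with rows marked by \<open>bs ! i\<close> and
  columns marked by \<open>bs ! j\<close>, and 0 where the two sizes differ.\<close>

definition wedges_mat :: "(nat \<Rightarrow> nat \<Rightarrow> 'a::comm_ring_1) \<Rightarrow> bool list list \<Rightarrow> 'a mat" where
  "wedges_mat a bs = mat (length bs) (length bs)
     (\<lambda>(i, j). wedges a (bits_word 0 (bs ! j)) one_bits (bs ! i))"

lemma wedges_mat_carrier [simp]: "wedges_mat a bs \<in> carrier_mat (length bs) (length bs)"
  by (simp add: wedges_mat_def)

lemma col_wedges_mat:
  "j < length bs \<Longrightarrow> col (wedges_mat a bs) j = vec_on bs (wedges a (bits_word 0 (bs ! j)) one_bits)"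
  by (rule eq_vecI) (simp_all add: wedges_mat_def)

lemma repr_mat_ext_map:
  fixes \<phi> :: "'a::comm_ring_1 mat"
  assumes bs: "distinct bs" "set bs = {s. length s = m \<and> odd (count_list s True) = b}"
    and \<phi>: "\<phi> \<in> carrier_mat m m"
  shows "repr_mat (ext_algebra m) (bits_basis m bs) (ext_map m \<phi>) = wedges_mat (mat_cols \<phi>) bs"
proof (rule eq_matI)
  fix i j assume "i < dim_row (wedges_mat (mat_cols \<phi>) bs)" "j < dim_col (wedges_mat (mat_cols \<phi>) bs)"
  then have ij: "i < length bs" "j < length bs" by (simp_all add: wedges_mat_def)
  let ?w = "bits_word 0 (bs ! j)"
  have bsj: "length (bs ! j) = m" "odd (length ?w) = b"
    using bs(2) nth_mem[OF ij(2)] by (auto simp: length_bits_word)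
  have bsi: "length (bs ! i) = m"
    using bs(2) nth_mem[OF ij(1)] by auto
  have single: "(single ?w :: nat list \<Rightarrow> 'a) \<in> tensors m"
    by (rule single_bits_word_tensors[OF bsj(1)])
  have coord: "ext_coord (tensor_map \<phi> (single ?w)) s = wedges (mat_cols \<phi>) ?w one_bits s"
    if "length s = m" for s
    using that \<phi> by (simp add: ext_coord_tensor_map)
  have "coords (ext_algebra m) (bits_basis m bs) (ext_map m \<phi> (bits_basis m bs ! j))
      = vec_on bs (ext_coord (tensor_map \<phi> (single ?w)))"
  proof -
    have "ext_coord (tensor_map \<phi> (single ?w)) s = 0" if "s \<in> bit_strings m" "s \<notin> set bs" for s
      using that coord[of s] bs(2) bsj(2) wedges_parity[of ?w s] by auto
    then show ?thesis
      using ij bs \<phi> single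
      by (subst coords_bits_basis[symmetric, where m = m])
        (auto simp: bits_basis_def ext_map_ext_class tensor_map_tensors)
  qed
  then show "repr_mat (ext_algebra m) (bits_basis m bs) (ext_map m \<phi>) $$ (i, j)
      = wedges_mat (mat_cols \<phi>) bs $$ (i, j)"
    using ij by (simp add: repr_mat_def wedges_mat_def coord[OF bsi])
qed (simp_all add: repr_mat_def wedges_mat_def)

section \<open>The induced map on coordinates and the intertwining relation\<close>

text \<open>The induced algebra endomorphism read in coordinates, as a map on all of the exterior
  algebra; \<open>wedges_mat\<close> is its restriction to a list of monomials.\<close>

definition ext_lin ::
    "nat \<Rightarrow> (nat \<Rightarrow> nat \<Rightarrow> 'a::comm_ring_1) \<Rightarrow> (bool list \<Rightarrow> 'a) \<Rightarrow> bool list \<Rightarrow> 'a" where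
  "ext_lin m a g = (\<lambda>t. \<Sum>s\<in>bit_strings m. g s * wedges a (bits_word 0 s) one_bits t)"

lemma ext_lin_cong:
  "(\<And>s. length s = m \<Longrightarrow> g s = h s) \<Longrightarrow> ext_lin m a g t = ext_lin m a h t"
  unfolding ext_lin_def by (rule sum.cong) simp_all

lemma ext_lin_diff: "ext_lin m a (\<lambda>s. g s - h s) t = ext_lin m a g t - ext_lin m a h t"
  by (simp add: ext_lin_def left_diff_distrib sum_subtractf)

lemma ext_lin_scale: "ext_lin m a (\<lambda>s. c * g s) t = c * ext_lin m a g t"
  by (simp add: ext_lin_def sum_distrib_left mult.assoc)

lemma ext_lin_ext_coord: "x \<in> tensors m \<Longrightarrow> ext_lin m a (ext_coord x) t = rep a x one_bits t"
  by (simp add: ext_lin_def rep_conv_ext_coord)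

lemma ext_lin_one: "ext_lin m a one_bits t = one_bits t"
  using ext_lin_ext_coord[OF tensors_one, of m a t] by (simp add: ext_coord_def)

text \<open>The induced map respects left multiplication by a vector. Lifting \<open>g\<close> to
  the tensor \<open>x\<close> reduces this to multiplicativity of \<open>rep\<close>.\<close>

lemma ext_lin_wedge:
  assumes "length t = m"
  shows "ext_lin m a (wedge v g) t = wedge (\<lambda>k. \<Sum>i<m. v i * a i k) (ext_lin m a g) t"
proof -
  define x where "x = bits_tensor m g"
  have x: "x \<in> tensors m" by (simp add: x_def bits_tensor_tensors)
  have coord: "ext_coord x s = g s" if "length s = m" for s
    using that by (simp add: x_def ext_coord_bits_tensor)
  have v: "vec m v \<in> carrier_vec m" by simp
  have "ext_lin m a (wedge v g) t
      = ext_lin m a (ext_coord (tensor_mult (tensor_of_vec (vec m v)) x)) t"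
  proof (rule ext_lin_cong)
    fix s :: "bool list" assume "length s = m"
    then show "wedge v g s = ext_coord (tensor_mult (tensor_of_vec (vec m v)) x) s"
      unfolding ext_coord_tensor_of_vec_mult[OF v x \<open>length s = m\<close>]
      by (intro clifford_cong) (simp_all add: coord)
  qed
  also have "\<dots> = wedge (\<lambda>k. \<Sum>i<m. vec m v $ i * a i k) (rep a x one_bits) t"
    using v x by (simp add: ext_lin_ext_coord tensors_mult tensors_of_vec rep_tensor_mult[of _ m]
        rep_tensor_of_vec[OF v])
  also have "rep a x one_bits = ext_lin m a g"
    unfolding ext_lin_ext_coord[OF x, symmetric] by (intro ext ext_lin_cong coord)
  also have "wedge (\<lambda>k. \<Sum>i<m. vec m v $ i * a i k) (ext_lin m a g) t
      = wedge (\<lambda>k. \<Sum>i<m. v i * a i k) (ext_lin m a g) t"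
    by (intro clifford_cong sum.cong) simp_all
  finally show ?thesis .
qed

lemma clifford_one_bits: "clifford u v one_bits s = wedge v one_bits s"
proof -
  have "clifford u (\<lambda>_. 0) one_bits s = 0" for u :: "nat \<Rightarrow> 'a"
  proof (induction s arbitrary: u)
    case (Cons b s)
    then show ?case by (cases b) simp_all
  qed simp
  then show ?thesis
    using clifford_add_vec[of u "\<lambda>_. 0" "\<lambda>_. 0" v one_bits s] by simp
qed

text \<open>Moving the operator past a letter \<open>i\<close> produces the scalar
  \<open>u' i\<close> on one side and the pairing of \<open>u\<close> with \<open>a i\<close> on the
  other; the first assumption equates them. The second settles the unit, on which contraction
  vanishes and only the wedge part acts.\<close>

lemma ext_lin_clifford:
  assumes u': "\<And>i. i < m \<Longrightarrow> u' i = (\<Sum>k<m. u k * a i k)"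
    and v: "\<And>k. k < m \<Longrightarrow> v k = (\<Sum>i<m. v' i * a i k)"
    and "set w \<subseteq> {..<m}" "length t = m"
  shows "ext_lin m a (clifford u' v' (wedges (unit_from 0) w one_bits)) t
      = clifford u v (wedges a w one_bits) t"
  using assms(3,4)
proof (induction w arbitrary: t)
  case Nil
  have "ext_lin m a (clifford u' v' one_bits) t = ext_lin m a (wedge v' one_bits) t"
    by (rule ext_lin_cong) (rule clifford_one_bits)
  also have "\<dots> = wedge (\<lambda>k. \<Sum>i<m. v' i * a i k) (ext_lin m a one_bits) t"
    by (rule ext_lin_wedge[OF Nil(2)])
  also have "\<dots> = wedge v one_bits t"
    by (rule clifford_cong) (use Nil v in \<open>simp_all add: ext_lin_one\<close>)
  finally show ?case by (simp add: clifford_one_bits[of u])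
next
  case (Cons i w)
  let ?e = "unit_from 0 :: nat \<Rightarrow> nat \<Rightarrow> 'a"
  let ?g = "wedges ?e w one_bits" and ?h = "wedges a w one_bits"
  have i: "i < m" using Cons.prems by simp
  have delta: "(\<Sum>k<m. f k * ?e i k) = f i" "(\<Sum>k<m. ?e i k * f k) = f i" for f
    using i by (simp_all add: unit_from_def if_distrib[of "\<lambda>t. _ * t"] if_distrib[of "\<lambda>t. t * _"]
        cong: if_cong)
  have g: "ext_lin m a ?g s = ?h s" for s
  proof -
    have "ext_lin m a (ext_coord (single w)) s = ?h s"
      using Cons.prems by (subst ext_lin_ext_coord) (simp_all add: tensors_single)
    then show ?thesis by (simp add: ext_coord_def)
  qed
  have "ext_lin m a (clifford u' v' (wedges ?e (i # w) one_bits)) t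
      = ext_lin m a (\<lambda>s. u' i * ?g s - wedge (?e i) (clifford u' v' ?g) s) t"
    by (rule ext_lin_cong) (simp add: clifford_wedge delta)
  also have "\<dots> = u' i * ?h t - wedge (a i) (ext_lin m a (clifford u' v' ?g)) t"
    using Cons.prems(2) by (simp add: ext_lin_diff ext_lin_scale ext_lin_wedge delta g)
  also have "wedge (a i) (ext_lin m a (clifford u' v' ?g)) t = wedge (a i) (clifford u v ?h) t"
    by (rule clifford_cong) (use Cons in simp_all)
  also have "u' i * ?h t - wedge (a i) (clifford u v ?h) t = clifford u v (wedge (a i) ?h) t"
    using Cons.prems(2) by (simp add: clifford_wedge u'[OF i])
  finally show ?case by simp
qed

text \<open>Functoriality: the vectors \<open>b i\<close> are pushed forward by \<open>a\<close>, so
  the family on the right describes \<open>a\<close> after \<open>b\<close>.\<close>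

lemma ext_lin_wedges:
  assumes "length t = m"
  shows "ext_lin m a (wedges b w one_bits) t = wedges (\<lambda>i k. \<Sum>j<m. b i j * a j k) w one_bits t"
  using assms
proof (induction w arbitrary: t)
  case Nil
  then show ?case by (simp add: ext_lin_one)
next
  case (Cons i w)
  then show ?case
    by (simp add: ext_lin_wedge) (rule clifford_cong, simp_all)
qed

lemma wedges_mat_mult_vec_on:
  assumes "distinct bs" "set bs \<subseteq> bit_strings m"
    and "\<And>s. s \<in> bit_strings m \<Longrightarrow> s \<notin> set bs \<Longrightarrow> g s = 0"
  shows "wedges_mat a bs *\<^sub>v vec_on bs g = vec_on bs (ext_lin m a g)"
proof (rule eq_vecI)
  fix i assume "i < dim_vec (vec_on bs (ext_lin m a g))"
  then have i: "i < length bs" by simp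
  have "(wedges_mat a bs *\<^sub>v vec_on bs g) $ i
      = (\<Sum>j<length bs. wedges a (bits_word 0 (bs ! j)) one_bits (bs ! i) * g (bs ! j))"
    using i by (simp add: wedges_mat_def scalar_prod_def lessThan_atLeast0)
  also have "\<dots> = (\<Sum>s\<in>set bs. wedges a (bits_word 0 s) one_bits (bs ! i) * g s)"
    by (rule sum.reindex_bij_betw[OF bij_betw_nth[OF assms(1) refl refl]])
  also have "\<dots> = ext_lin m a g (bs ! i)"
    unfolding ext_lin_def
    by (rule sum.mono_neutral_cong_left)
      (use assms(2,3) in \<open>auto simp: finite_bit_strings mult.commute\<close>)
  finally show "(wedges_mat a bs *\<^sub>v vec_on bs g) $ i = vec_on bs (ext_lin m a g) $ i"
    using i by simp
qed (simp add: wedges_mat_def)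

lemma wedges_outside_parity:
  assumes bs: "set bs = {s. length s = m \<and> odd (count_list s True) = b}" and s: "s \<in> set bs"
    and t: "t \<in> bit_strings m" "t \<notin> set bs"
  shows "wedges a (bits_word 0 s) one_bits t = 0"
  by (rule wedges_parity) (use assms in \<open>auto simp: length_bits_word\<close>)

text \<open>Functoriality gives the family of the product; \<open>inv\<close> makes it agree with
  the unit vectors at indices below \<open>m\<close>, which are the only ones that occur
  here.\<close>

lemma wedges_mat_inverse:
  fixes a b :: "nat \<Rightarrow> nat \<Rightarrow> 'a::comm_ring_1"
  assumes bs: "distinct bs" "set bs = {s. length s = m \<and> odd (count_list s True) = c}"
    and inv: "\<And>i k. i < m \<Longrightarrow> k < m \<Longrightarrow> (\<Sum>j<m. b i j * a j k) = (if k = i then 1 else 0)"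
  shows "wedges_mat a bs * wedges_mat b bs = 1\<^sub>m (length bs)"
proof (rule eq_matI)
  fix i j assume "i < dim_row (1\<^sub>m (length bs) :: 'a mat)" "j < dim_col (1\<^sub>m (length bs) :: 'a mat)"
  then have ij: "i < length bs" "j < length bs" by simp_all
  let ?w = "bits_word 0 (bs ! j)"
  have len: "length (bs ! i) = m" "length (bs ! j) = m"
    using bs(2) nth_mem[OF ij(1)] nth_mem[OF ij(2)] by auto
  have sub: "set bs \<subseteq> bit_strings m" using bs(2) by auto
  have "(wedges_mat a bs * wedges_mat b bs) $$ (i, j) = col (wedges_mat a bs * wedges_mat b bs) j $ i"
    using ij by (simp add: wedges_mat_def)
  also have "col (wedges_mat a bs * wedges_mat b bs) j
      = wedges_mat a bs *\<^sub>v vec_on bs (wedges b ?w one_bits)"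
    using ij by (subst col_mult2[OF wedges_mat_carrier wedges_mat_carrier]) (simp_all add: col_wedges_mat)
  also have "\<dots> = vec_on bs (ext_lin m a (wedges b ?w one_bits))"
    by (rule wedges_mat_mult_vec_on[OF bs(1) sub])
      (use ij in \<open>auto intro!: wedges_outside_parity[OF bs(2)]\<close>)
  also have "\<dots> $ i = wedges (\<lambda>i k. \<Sum>j<m. b i j * a j k) ?w one_bits (bs ! i)"
    using ij len by (simp add: ext_lin_wedges)
  also have "\<dots> = wedges (unit_from 0) ?w one_bits (bs ! i)"
  proof (rule wedges_cong)
    fix i' k assume "i' \<in> set ?w" "k < length (bs ! i)"
    then have "i' < m" "k < m" using set_bits_word[of 0 "bs ! j"] len by auto
    then show "(\<Sum>j<m. b i' j * a j k) = unit_from 0 i' k"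
      by (simp add: inv unit_from_def)
  qed simp
  also have "\<dots> = 1\<^sub>m (length bs) $$ (i, j)"
    using ij len bs(1) by (simp add: wedges_bits_word nth_eq_iff_index_eq)
  finally show "(wedges_mat a bs * wedges_mat b bs) $$ (i, j) = 1\<^sub>m (length bs) $$ (i, j)" .
qed (simp_all add: wedges_mat_def)

lemma mat_inv_eqI:
  fixes A B :: "'a::comm_ring_1 mat"
  assumes "A \<in> carrier_mat n n" "B \<in> carrier_mat n n" "A * B = 1\<^sub>m n" "B * A = 1\<^sub>m n"
  shows "mat_inv A = B"
proof -
  interpret ring "ring_mat TYPE('a) n ()" by (rule ring_mat)
  have "B = inv\<^bsub>ring_mat TYPE('a) n ()\<^esub> A"
    by (rule inv_unique') (use assms in \<open>simp_all add: ring_mat_simps\<close>)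
  with assms(1) show ?thesis by simp
qed

text \<open>Compared column by column: column \<open>j\<close> of either side is the image of the
  \<open>j\<close>-th odd monomial, so \<open>ext_lin_clifford\<close> applies to the word of that
  monomial.\<close>

lemma suslin_intertwine:
  fixes u v u' v' :: "'a::comm_ring_1 vec"
  assumes dims: "dim_vec u = Suc n" "dim_vec v = Suc n" "dim_vec u' = Suc n" "dim_vec v' = Suc n"
    and u': "\<And>i. i < Suc n \<Longrightarrow> u' $ i = (\<Sum>k<Suc n. u $ k * a i k)"
    and v: "\<And>k. k < Suc n \<Longrightarrow> v $ k = (\<Sum>i<Suc n. v' $ i * a i k)"
  shows "wedges_mat a (even_bits (Suc n)) * suslin (Suc n) u' v'
      = suslin (Suc n) u v * wedges_mat a (odd_bits (Suc n))" (is "?B * ?S' = ?S * ?A")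
proof (rule mat_col_eqI)
  let ?ev = "even_bits (Suc n)" and ?od = "odd_bits (Suc n)"
  have B: "?B \<in> carrier_mat (2 ^ n) (2 ^ n)" and A: "?A \<in> carrier_mat (2 ^ n) (2 ^ n)"
    using wedges_mat_carrier[of a ?ev] wedges_mat_carrier[of a ?od] unfolding length_bits .
  note S = suslin_carrier[of n u v] suslin_carrier[of n u' v']
  fix j assume "j < dim_col (?S * ?A)"
  then have j: "j < 2 ^ n" "j < length ?od" using A by (simp_all add: length_bits del: odd_bits.simps)
  let ?s = "?od ! j"
  let ?w = "bits_word 0 ?s"
  have s: "length ?s = Suc n" "odd (length ?w)"
    using nth_mem[OF j(2)] unfolding in_set_bits by (simp_all add: length_bits_word)
  have w: "set ?w \<subseteq> {..<Suc n}" using set_bits_word[of 0 ?s] s(1) by auto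
  have "col (?S * ?A) j = ?S *\<^sub>v vec_on ?od (wedges a ?w one_bits)"
    using j by (subst col_mult2[OF S(1) A]) (simp_all only: col_wedges_mat)
  also have "\<dots> = vec_on ?ev (clifford (($) u) (($) v) (wedges a ?w one_bits))"
    by (rule suslin_mult_vec_on[OF dims(1,2), THEN conjunct1])
  finally have right: "col (?S * ?A) j = \<dots>" .
  \<comment> \<open>The coordinates of the \<open>j\<close>-th odd monomial form the
    \<open>j\<close>-th unit vector; writing it through \<open>wedges\<close> brings the column into
    the shape of \<open>ext_lin_clifford\<close>.\<close>
  have unit: "col ?S' j = ?S' *\<^sub>v vec_on ?od (wedges (unit_from 0) ?w one_bits)"
  proof -
    have "vec_on ?od (wedges (unit_from 0) ?w one_bits) = (unit_vec (2 ^ n) j :: 'a vec)"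
    proof (rule eq_vecI)
      fix i assume "i < dim_vec (unit_vec (2 ^ n) j :: 'a vec)"
      then have i: "i < 2 ^ n" "i < length ?od" by (simp_all add: length_bits del: odd_bits.simps)
      have "length (?od ! i) = length ?s"
        using nth_mem[OF i(2)] s(1) unfolding in_set_bits by simp
      then show "vec_on ?od (wedges (unit_from 0) ?w one_bits) $ i = (unit_vec (2 ^ n) j :: 'a vec) $ i"
        using i j distinct_bits(2)[of "Suc n"]
        by (simp add: wedges_bits_word nth_eq_iff_index_eq del: odd_bits.simps)
    qed (simp add: length_bits del: odd_bits.simps)
    moreover have "?S' *\<^sub>v unit_vec (2 ^ n) j = col ?S' j"
      by (rule eq_vecI) (use S(2) j in auto)
    ultimately show ?thesis by (simp only:)
  qed
  have "col (?B * ?S') j = ?B *\<^sub>v vec_on ?ev (clifford (($) u') (($) v') (wedges (unit_from 0) ?w one_bits))"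
    unfolding col_mult2[OF B S(2) j(1)] unit suslin_mult_vec_on[OF dims(3,4), THEN conjunct1] ..
  also have "\<dots> = vec_on ?ev (ext_lin (Suc n) a (clifford (($) u') (($) v') (wedges (unit_from 0) ?w one_bits)))"
  proof (rule wedges_mat_mult_vec_on)
    \<comment> \<open>The operator turns an odd monomial into an even element, so the even list
      carries all of its coordinates.\<close>
    fix t assume "t \<in> bit_strings (Suc n)" "t \<notin> set ?ev"
    then have "odd (count_list t True)" unfolding in_set_bits by simp
    then show "clifford (($) u') (($) v') (wedges (unit_from 0) ?w one_bits) t = 0"
      by (intro clifford_parity wedges_parity) (use s(2) in simp)
  qed (auto simp: in_set_bits distinct_bits simp del: even_bits.simps)
  also have "\<dots> = vec_on ?ev (clifford (($) u) (($) v) (wedges a ?w one_bits))"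
  proof (rule eq_vecI)
    fix i assume "i < dim_vec (vec_on ?ev (clifford (($) u) (($) v) (wedges a ?w one_bits)))"
    then have i: "i < length ?ev" by simp
    have "length (?ev ! i) = Suc n" using nth_mem[OF i] unfolding in_set_bits by simp
    from ext_lin_clifford[OF u' v w this] i
    show "vec_on ?ev (ext_lin (Suc n) a (clifford (($) u') (($) v') (wedges (unit_from 0) ?w one_bits))) $ i
        = vec_on ?ev (clifford (($) u) (($) v) (wedges a ?w one_bits)) $ i"
      by (simp del: even_bits.simps odd_bits.simps)
  qed simp
  finally show "col (?B * ?S') j = col (?S * ?A) j"
    unfolding right .
qed (use suslin_carrier[of n u v] suslin_carrier[of n u' v'] in
      \<open>simp_all add: wedges_mat_def length_bits del: even_bits.simps odd_bits.simps\<close>)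

theorem corollary3p7:
  fixes n :: nat
  shows "\<exists>bs1 bs0 :: (nat list \<Rightarrow> 'a::comm_ring_1) set list.
    ordered_basis (ext_algebra (n + 1)) (ext_odd (n + 1)) bs1 \<and>
    ordered_basis (ext_algebra (n + 1)) (ext_even (n + 1)) bs0 \<and>
    (\<forall>(a::'a) (b::'a). \<forall>p\<in>carrier_vec n. \<forall>f\<in>carrier_vec n. \<forall>\<phi>\<in>carrier_mat (n + 1) (n + 1).
       det \<phi> = 1 \<longrightarrow>
       (let A = repr_mat (ext_algebra (n + 1)) bs1 (ext_map (n + 1) \<phi>);
            B = repr_mat (ext_algebra (n + 1)) bs0 (ext_map (n + 1) \<phi>)
        in suslin (n + 1) (form_comp (vCons b f) \<phi>) (mat_inv \<phi> *\<^sub>v vCons a p) =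
             mat_inv B * suslin (n + 1) (vCons b f) (vCons a p) * A))"
proof -
  let ?m = "Suc n"
  let ?od = "odd_bits ?m" and ?ev = "even_bits ?m"
  let ?bs1 = "bits_basis ?m ?od :: (nat list \<Rightarrow> 'a) set list"
  let ?bs0 = "bits_basis ?m ?ev :: (nat list \<Rightarrow> 'a) set list"
  have od: "distinct ?od" "set ?od = {s. length s = ?m \<and> odd (count_list s True) = True}"
    and ev: "distinct ?ev" "set ?ev = {s. length s = ?m \<and> odd (count_list s True) = False}"
    by (auto simp: in_set_bits distinct_bits simp del: odd_bits.simps even_bits.simps)
  have basis: "ordered_basis (ext_algebra ?m) (ext_odd ?m) ?bs1"
      "ordered_basis (ext_algebra ?m) (ext_even ?m) ?bs0"
    using ordered_basis_bits_basis[OF od, where ?'a = 'a] ordered_basis_bits_basis[OF ev, where ?'a = 'a]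
    by (simp_all add: ext_odd_def ext_even_def del: odd_bits.simps even_bits.simps)
  have main: "suslin ?m (form_comp (vCons b f) \<phi>) (mat_inv \<phi> *\<^sub>v vCons a p) =
      mat_inv (repr_mat (ext_algebra ?m) ?bs0 (ext_map ?m \<phi>)) * suslin ?m (vCons b f) (vCons a p)
        * repr_mat (ext_algebra ?m) ?bs1 (ext_map ?m \<phi>)"
    if p: "p \<in> carrier_vec n" and f: "f \<in> carrier_vec n"
      and \<phi>: "\<phi> \<in> carrier_mat ?m ?m" and det: "det \<phi> = 1"
    for a b :: 'a and p f \<phi>
  proof -
    \<comment> \<open>With determinant 1 the adjugate is a two-sided inverse, over any commutative
      ring.\<close>
    define \<psi> where "\<psi> = adj_mat \<phi>"
    have \<psi>: "\<psi> \<in> carrier_mat ?m ?m" "\<phi> * \<psi> = 1\<^sub>m ?m" "\<psi> * \<phi> = 1\<^sub>m ?m"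
      using adj_mat[OF \<phi>] det by (auto simp: \<psi>_def)
    have inv: "mat_inv \<phi> = \<psi>"
      by (rule mat_inv_eqI[OF \<phi> \<psi>])
    let ?u = "vCons b f" and ?v = "vCons a p"
    let ?u' = "form_comp ?u \<phi>" and ?v' = "\<psi> *\<^sub>v ?v"
    let ?a = "mat_cols \<phi>" and ?b = "mat_cols \<psi>"
    have u: "?u \<in> carrier_vec ?m" and v: "?v \<in> carrier_vec ?m"
      using p f by auto
    have dims: "dim_vec ?u = ?m" "dim_vec ?v = ?m" "dim_vec ?u' = ?m" "dim_vec ?v' = ?m"
      using u v \<phi> \<psi>(1) by (auto simp: form_comp_def)
    have u': "?u' $ i = (\<Sum>k<?m. ?u $ k * ?a i k)" if "i < ?m" for i
      using that u \<phi> by (simp add: form_comp_def scalar_prod_def lessThan_atLeast0 mat_cols_def)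
    \<comment> \<open>The intertwining relation asks for \<open>v\<close> in terms of
      \<open>v'\<close>, so the definition of \<open>v'\<close> is solved back by applying
      \<open>\<phi>\<close>.\<close>
    have v': "?v $ k = (\<Sum>i<?m. ?v' $ i * ?a i k)" if "k < ?m" for k
    proof -
      have "?v = \<phi> *\<^sub>v ?v'"
        using v \<phi> \<psi> by (simp add: assoc_mult_mat_vec[symmetric, of _ ?m ?m _ ?m])
      then have "?v $ k = (\<phi> *\<^sub>v ?v') $ k" by simp
      also have "\<dots> = (\<Sum>i<?m. ?v' $ i * ?a i k)"
        using that \<phi> dims(4)
        by (simp add: scalar_prod_def lessThan_atLeast0 mat_cols_def mult.commute
            del: sum.lessThan_Suc)
      finally show ?thesis .
    qed
    have prod: "(\<Sum>j<?m. mat_cols Y i j * mat_cols X j k) = (if k = i then 1 else 0)"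
      if "X * Y = 1\<^sub>m ?m" "X \<in> carrier_mat ?m ?m" "Y \<in> carrier_mat ?m ?m" "i < ?m" "k < ?m"
      for X Y :: "'a mat" and i k
    proof -
      have "(X * Y) $$ (k, i) = (\<Sum>j<?m. mat_cols Y i j * mat_cols X j k)"
        using that(2-5)
        by (simp add: scalar_prod_def lessThan_atLeast0 mat_cols_def mult.commute)
      with that show ?thesis by simp
    qed
    let ?B = "wedges_mat ?a ?ev" and ?B' = "wedges_mat ?b ?ev" and ?A = "wedges_mat ?a ?od"
    let ?S = "suslin ?m ?u ?v" and ?S' = "suslin ?m ?u' ?v'"
    have carriers: "?B \<in> carrier_mat (2 ^ n) (2 ^ n)" "?B' \<in> carrier_mat (2 ^ n) (2 ^ n)"
        "?A \<in> carrier_mat (2 ^ n) (2 ^ n)"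
        "?S \<in> carrier_mat (2 ^ n) (2 ^ n)" "?S' \<in> carrier_mat (2 ^ n) (2 ^ n)"
      using wedges_mat_carrier[of ?a ?ev] wedges_mat_carrier[of ?b ?ev] wedges_mat_carrier[of ?a ?od]
        suslin_carrier unfolding length_bits by auto
    have BB': "?B * ?B' = 1\<^sub>m (2 ^ n)" "?B' * ?B = 1\<^sub>m (2 ^ n)"
      using wedges_mat_inverse[OF ev, of ?b ?a] wedges_mat_inverse[OF ev, of ?a ?b]
        prod[OF \<psi>(2) \<phi> \<psi>(1)] prod[OF \<psi>(3) \<psi>(1) \<phi>]
      unfolding length_bits by blast+
    \<comment> \<open>Insert the identity \<open>?B' * ?B\<close> so that the intertwining relation
      can be used inside the product.\<close>
    have "?S' = ?B' * (?B * ?S')"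
      using carriers BB' by (simp add: assoc_mult_mat[symmetric, of _ "2 ^ n" "2 ^ n" _ "2 ^ n" _ "2 ^ n"])
    also have "?B * ?S' = ?S * ?A"
      by (rule suslin_intertwine[OF dims u' v'])
    also have "?B' * (?S * ?A) = ?B' * ?S * ?A"
      by (rule assoc_mult_mat[symmetric]) (use carriers in auto)
    also have "?B' = mat_inv ?B"
      by (rule mat_inv_eqI[OF carriers(1,2) BB', symmetric])
    finally show ?thesis
      unfolding inv repr_mat_ext_map[OF od \<phi>] repr_mat_ext_map[OF ev \<phi>] .
  qed
  show ?thesis
    unfolding Suc_eq_plus1[symmetric] Let_def
    by (intro exI[of _ ?bs1] exI[of _ ?bs0] conjI basis allI ballI impI main)
qed

end
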